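(* Let $m\ge 1$ be an integer, $p$ a prime, and $S$ a matrix as in the context with $s_{0,1}s_{1,2}\cdots s_{m-1,m}\neq 0$. Let $\mathcal F=\{F_0,\ldots,F_m\}\in\mathfrak F(S,m)$ be a polynomial system over $\mathbb F_p$ of total degree $d\ge 2$, and let $\mathbf w_n=(u_{n,0},\ldots,u_{n,m})$, $n\ge 0$, be the sequence generated by iterating $\mathcal F$ from an initial vector $\mathbf w_0\in\mathbb F_p^{m+1}$. Assume that $\{\mathbf w_n\}$ is purely periodic with (least) period $\tau$. Then for any fixed integer $\nu\ge 1$, any positive integer $N\le\tau$ and any nonzero vector $\mathbf a=(a_0,\ldots,a_{m-1})\in\mathbb F_p^m$, the bound $$\left|\sum_{n=0}^{N-1}\mathbf e_p\Big(\sum_{i=0}^{m-1}a_iu_{n,i}\Big)\right|\ll N^{1-\beta_{m,\nu}}\,p^{\alpha_{m,\nu}}$$ holds, where $$\alpha_{m,\nu}=\frac{m^2+m\nu+m}{2\nu(m+\nu)}\qquad\text{and}\qquad \beta_{m,\nu}=\frac1{2\nu},$$ and the implied constant depends only on $d$, $m$ and $\nu$.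
   Context: $\mathbf e_p(z)=\exp(2\pi i z/p)$. The field $\mathbb F_p$ is represented by $\{0,1,\ldots,p-1\}$, so its elements are also regarded as integers. $A\ll B$ means $|A|\le cB$ for some constant $c>0$. $S$ is an integral upper triangular $(m+1)\times(m+1)$ matrix, rows and columns indexed by $0,\ldots,m$, with ones on the diagonal and entries $s_{i,j}$ for $0\le i<j\le m$ (used as exponents, hence non-negative). $\mathfrak F(S,m)$ is the set of all systems $\{F_0,\ldots,F_m\}$ of polynomials in $\mathbb F_p[X_0,\ldots,X_m]$ of the form $$F_i=X_iG_i(X_{i+1},\ldots,X_m)+H_i(X_{i+1},\ldots,X_m)\quad (0\le i\le m-1),\qquad F_m=g_mX_m+h_m,$$ with $g_m,h_m\in\mathbb F_p$, $g_m\ne0$, $G_i,H_i\in\mathbb F_p[X_{i+1},\ldots,X_m]$, where for $0\le i\le m-1$ $$G_i=g_iX_{i+1}^{s_{i,i+1}}\cdots X_m^{s_{i,m}}+\widetilde G_i,\qquad g_i\in\mathbb F_p^*,$$ and $\deg_{X_j}\widetilde G_i<s_{i,j}$, $\deg_{X_j}H_i\le s_{i,j}$ for $j=i+1,\ldots,m$ (the zero polynomial has degree $-\infty$). The sequence generated by iterating $\mathcal F$: $u_{n+1,i}\equiv F_i(u_{n,0},\ldots,u_{n,m})\pmod p$ with $0\le u_{n,i}<p$, for $i=0,\ldots,m$, $n\ge0$. Purely periodic with period $\tau$ means $\mathbf w_{n+\tau}=\mathbf w_n$ for all $n\ge0$, with $\tau$ the least such positive integer. *)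

theory Defs
  imports
    Complex_Main
    "HOL-Library.Extended_Real"
    "HOL-Library.Poly_Mapping"
    "HOL-Computational_Algebra.Primes"
    "Jordan_Normal_Form.Matrix"
begin

text \<open>
  The prime \<open>p\<close> is quantified inside the statement (the implied constant must not depend on it), so
  the field with \<open>p\<close> elements is not a type here. Its elements are the integers \<open>0, \<dots>, p - 1\<close>, with
  arithmetic modulo \<open>p\<close>.
\<close>

definition Fp :: "nat \<Rightarrow> int set" where
  "Fp p = {0..<int p}"

definition Fp_vec :: "nat \<Rightarrow> nat \<Rightarrow> int vec set" where
  "Fp_vec p n = {v \<in> carrier_vec n. \<forall>i<n. v $ i \<in> Fp p}"


text \<open>
  Polynomials in variables \<open>X\<^sub>0, X\<^sub>1, \<dots>\<close>: a finitely supported map from monomials (exponent vectors,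
  themselves finitely supported) to coefficients. Those over the field with \<open>p\<close> elements are the
  ones whose coefficients lie in \<^term>\<open>Fp p\<close>. The library ring operations are those over the
  integers; composed with \<open>reduce p\<close> they are the operations modulo \<open>p\<close>.
\<close>

type_synonym mpol = "(nat \<Rightarrow>\<^sub>0 nat) \<Rightarrow>\<^sub>0 int"

definition Const :: "int \<Rightarrow> mpol" where
  "Const c = Poly_Mapping.single 0 c"

definition Var :: "nat \<Rightarrow> mpol" where
  "Var j = Poly_Mapping.single (Poly_Mapping.single j 1) 1"

definition reduce :: "nat \<Rightarrow> mpol \<Rightarrow> mpol" where
  "reduce p P = Poly_Mapping.map (\<lambda>c. c mod int p) P"

definition Fp_polys :: "nat \<Rightarrow> nat set \<Rightarrow> mpol set" where
  "Fp_polys p V =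
     {P. (\<forall>t. Poly_Mapping.lookup P t \<in> Fp p) \<and>
         (\<forall>t \<in> Poly_Mapping.keys P. Poly_Mapping.keys t \<subseteq> V)}"

definition eval_mod :: "nat \<Rightarrow> mpol \<Rightarrow> int vec \<Rightarrow> int" where
  "eval_mod p P x =
     (\<Sum>t \<in> Poly_Mapping.keys P. Poly_Mapping.lookup P t *
        (\<Prod>j \<in> Poly_Mapping.keys t. x $ j ^ Poly_Mapping.lookup t j)) mod int p"

text \<open>
  Degrees take values in the extended reals so that the zero polynomial has degree \<open>-\<infinity>\<close>, which is the
  supremum of the empty set.
\<close>

definition deg_in :: "nat \<Rightarrow> mpol \<Rightarrow> ereal" where
  "deg_in j P = (SUP t \<in> Poly_Mapping.keys P. ereal (real (Poly_Mapping.lookup t j)))"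

definition total_deg :: "mpol \<Rightarrow> ereal" where
  "total_deg P =
     (SUP t \<in> Poly_Mapping.keys P.
        ereal (real (\<Sum>j \<in> Poly_Mapping.keys t. Poly_Mapping.lookup t j)))"


text \<open>The entries of \<open>S\<close> serve as exponents, hence the entry type \<^typ>\<open>nat\<close>.\<close>

definition exponent_matrix :: "nat \<Rightarrow> nat mat \<Rightarrow> bool" where
  "exponent_matrix m S \<longleftrightarrow>
     S \<in> carrier_mat (m + 1) (m + 1) \<and> upper_triangular S \<and> (\<forall>i\<le>m. S $$ (i, i) = 1)"

text \<open>
  A system \<open>F\<^sub>0, \<dots>, F\<^sub>m\<close> is a function on indices, of which only the values at \<open>0, \<dots>, m\<close> matter.
\<close>

definition poly_systems :: "nat \<Rightarrow> nat mat \<Rightarrow> nat \<Rightarrow> (nat \<Rightarrow> mpol) set" where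
  "poly_systems p S m =
     {F. (\<forall>i\<le>m. F i \<in> Fp_polys p {0..m}) \<and>
         (\<forall>i<m. \<exists>G \<in> Fp_polys p {i+1..m}. \<exists>H \<in> Fp_polys p {i+1..m}.
            F i = reduce p (Var i * G + H) \<and>
            (\<exists>g \<in> Fp p - {0}. \<exists>G' \<in> Fp_polys p {i+1..m}.
               G = reduce p (Const g * (\<Prod>j\<in>{i+1..m}. Var j ^ (S $$ (i, j))) + G') \<and>
               (\<forall>j\<in>{i+1..m}. deg_in j G' < ereal (real (S $$ (i, j))))) \<and>
            (\<forall>j\<in>{i+1..m}. deg_in j H \<le> ereal (real (S $$ (i, j))))) \<and>
         (\<exists>g \<in> Fp p - {0}. \<exists>h \<in> Fp p. F m = reduce p (Const g * Var m + Const h))}"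

definition system_deg :: "nat \<Rightarrow> (nat \<Rightarrow> mpol) \<Rightarrow> ereal" where
  "system_deg m F = (SUP i \<in> {0..m}. total_deg (F i))"

primrec orbit :: "nat \<Rightarrow> nat \<Rightarrow> (nat \<Rightarrow> mpol) \<Rightarrow> int vec \<Rightarrow> nat \<Rightarrow> int vec" where
  "orbit p m F w0 0 = w0"
| "orbit p m F w0 (Suc n) = vec (m + 1) (\<lambda>i. eval_mod p (F i) (orbit p m F w0 n))"

definition purely_periodic :: "(nat \<Rightarrow> 'a) \<Rightarrow> nat \<Rightarrow> bool" where
  "purely_periodic w \<tau> \<longleftrightarrow>
     0 < \<tau> \<and> (\<forall>n. w (n + \<tau>) = w n) \<and> (\<forall>t. 0 < t \<and> (\<forall>n. w (n + t) = w n) \<longrightarrow> \<tau> \<le> t)"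

definition e\<^sub>p :: "nat \<Rightarrow> int \<Rightarrow> complex" where
  "e\<^sub>p p z = exp (2 * complex_of_real pi * \<i> * of_int z / of_nat p)"

definition \<alpha> :: "nat \<Rightarrow> nat \<Rightarrow> real" where
  "\<alpha> m \<nu> = (real m ^ 2 + real m * real \<nu> + real m) / (2 * real \<nu> * (real m + real \<nu>))"

definition \<beta> :: "nat \<Rightarrow> nat \<Rightarrow> real" where
  "\<beta> m \<nu> = 1 / (2 * real \<nu>)"

end

theory Submission
  imports
    Defs
    "HOL-Computational_Algebra.Polynomial"
    "HOL-Library.FuncSet"
    "HOL-Number_Theory.Cong"
    "HOL-Analysis.Convex"
begin

text \<open>
  Each \<open>F\<^sub>i\<close> is linear in \<open>X\<^sub>i\<close> with coefficients in the later variables, and so is each component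
  \<open>F\<^sub>i\<^sup>(\<^sup>k\<^sup>)\<close> of an iterate: it equals \<open>X\<^sub>i\<close> times a slope plus an offset, both free of \<open>X\<^sub>0, \<dots>, X\<^sub>i\<close>. The slope
  is the product of the values of \<open>G\<^sub>i\<close> along the first \<open>k\<close> iterates. As a polynomial in \<open>X\<^sub>i\<^sub>+\<^sub>1\<close> every
  factor has degree exactly \<open>s\<^sub>i\<^sub>,\<^sub>i\<^sub>+\<^sub>1\<close>, so the slope has degree \<open>k s\<^sub>i\<^sub>,\<^sub>i\<^sub>+\<^sub>1\<close>: the degree grows with \<open>k\<close>, but only
  linearly. This is where \<open>s\<^sub>i\<^sub>,\<^sub>i\<^sub>+\<^sub>1 \<noteq> 0\<close> enters.

  Two consequences follow. A combination \<open>\<Sum>\<^sub>k c\<^sub>k slope\<^sub>i\<^sub>,\<^sub>k\<close> with \<open>k < K\<close> whose last nonzero coefficient is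
  not divisible by \<open>p\<close> has a visible top coefficient in \<open>X\<^sub>i\<^sub>+\<^sub>1\<close>. That top coefficient vanishes only
  where an earlier slope or iterate with larger index does, so an induction on the index bounds the
  number of zeros of the combination by \<open>O(K\<^sup>m p\<^sup>m)\<close> out of \<open>p\<^sup>m\<^sup>+\<^sup>1\<close> points (\<open>zeros_combination_bound\<close>).
  And a complete sum over all points of a character of \<open>\<Sum>\<^sub>k c\<^sub>k \<Sum>\<^sub>i a\<^sub>i F\<^sub>i\<^sup>(\<^sup>k\<^sup>)\<close> has a phase that is linear
  in the variable of the first nonzero \<open>a\<^sub>i\<close>; summing over that variable first leaves at most the number of those zeros.

  The incomplete sum over the orbit is compared with its shifts by \<open>k < K\<close>, at a cost of \<open>O(K)\<close>. After
  the power mean inequality with exponent \<open>2\<nu>\<close>, the average over the \<open>N\<close> distinct orbit points is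
  extended to all points. Expanding the \<open>2\<nu>\<close>-th moment gives one complete sum for each pair of
  \<open>\<nu>\<close>-tuples of shifts: the \<open>O(K\<^sup>\<nu>)\<close> pairs that agree as multisets contribute \<open>p\<^sup>m\<^sup>+\<^sup>1\<close> each, every other pair
  contributes \<open>O(K\<^sup>m p\<^sup>m)\<close> (\<open>moment_bound\<close>). The choice \<open>K \<approx> p\<^bsup>1/(m+\<nu>)\<^esup>\<close> balances the two parts and
  produces the exponents of the theorem (\<open>optimised_estimate\<close>). The coefficients
  \<open>c\<^sub>k\<close> that occur are differences of multiplicities in two \<open>\<nu>\<close>-tuples, so they lie between \<open>-\<nu>\<close> and \<open>\<nu>\<close>
  and the nonzero ones are invertible modulo \<open>p\<close> once \<open>p > \<nu>\<close>; for the finitely many smaller primes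
  \<open>N \<le> p\<^sup>m\<^sup>+\<^sup>1\<close> is itself bounded.

  Composing multivariate polynomials is avoided: the iterates are integer valued functions on integer
  points, and they are treated as polynomials in one coordinate at a time.
\<close>


section \<open>Polynomial functions with a prescribed top coefficient\<close>

text \<open>
  The degree is only bounded by \<open>n\<close> and \<open>a\<close> may be zero, even modulo \<open>p\<close>. In this form the property is
  preserved by products, sums and linear substitutions without any case distinction, and the
  question whether \<open>p\<close> divides \<open>a\<close> is asked once, when zeros are counted.
\<close>
definition top_coeff_fun :: "nat \<Rightarrow> int \<Rightarrow> (int \<Rightarrow> int) \<Rightarrow> bool" where
  "top_coeff_fun n a f \<longleftrightarrow> (\<exists>P::int poly. degree P \<le> n \<and> coeff P n = a \<and> (\<forall>t. f t = poly P t))"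

lemma top_coeff_fun_const: "top_coeff_fun 0 a (\<lambda>_. a)"
  unfolding top_coeff_fun_def by (rule exI[of _ "[:a:]"]) simp

lemma coeff_mult_top:
  fixes P Q :: "'a::comm_semiring_0 poly"
  assumes "degree P \<le> n" "degree Q \<le> k"
  shows "coeff (P * Q) (n + k) = coeff P n * coeff Q k"
proof -
  have "coeff (P * Q) (n + k) = (\<Sum>i\<le>n+k. coeff P i * coeff Q (n + k - i))"
    by (rule coeff_mult)
  also have "\<dots> = (\<Sum>i\<in>{n}. coeff P i * coeff Q (n + k - i))"
  proof (rule sum.mono_neutral_right)
    show "\<forall>i\<in>{..n + k} - {n}. coeff P i * coeff Q (n + k - i) = 0"
    proof
      fix i assume "i \<in> {..n + k} - {n}"
      then have "i > n \<or> n + k - i > k" by auto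
      then show "coeff P i * coeff Q (n + k - i) = 0"
        using assms by (auto simp: coeff_eq_0)
    qed
  qed auto
  finally show ?thesis by simp
qed

lemma top_coeff_fun_mult:
  assumes "top_coeff_fun n a f" "top_coeff_fun k b g"
  shows "top_coeff_fun (n + k) (a * b) (\<lambda>t. f t * g t)"
proof -
  from assms obtain P Q where "degree P \<le> n" "coeff P n = a" "\<forall>t. f t = poly P t"
    "degree Q \<le> k" "coeff Q k = b" "\<forall>t. g t = poly Q t" unfolding top_coeff_fun_def by blast
  then show ?thesis unfolding top_coeff_fun_def
    by (intro exI[of _ "P * Q"])
       (auto simp: coeff_mult_top intro: order.trans[OF degree_mult_le])
qed

lemma top_coeff_fun_cmult: "top_coeff_fun n a f \<Longrightarrow> top_coeff_fun n (c * a) (\<lambda>t. c * f t)"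
  using top_coeff_fun_mult[OF top_coeff_fun_const[of c], of n a f] by simp

lemma top_coeff_fun_add:
  assumes "top_coeff_fun n a f" "top_coeff_fun n b g"
  shows "top_coeff_fun n (a + b) (\<lambda>t. f t + g t)"
proof -
  from assms obtain P Q where "degree P \<le> n" "coeff P n = a" "\<forall>t. f t = poly P t"
    "degree Q \<le> n" "coeff Q n = b" "\<forall>t. g t = poly Q t" unfolding top_coeff_fun_def by blast
  then show ?thesis unfolding top_coeff_fun_def
    by (intro exI[of _ "P + Q"]) (auto intro: degree_add_le)
qed

lemma top_coeff_fun_raise:
  assumes "top_coeff_fun n a f" "n < k"
  shows "top_coeff_fun k 0 f"
proof -
  from assms(1) obtain P where "degree P \<le> n" "\<forall>t. f t = poly P t"
    unfolding top_coeff_fun_def by blast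
  then show ?thesis using assms(2) unfolding top_coeff_fun_def
    by (intro exI[of _ P]) (auto simp: coeff_eq_0)
qed

lemma top_coeff_fun_zero: "top_coeff_fun n 0 (\<lambda>_. 0)"
  unfolding top_coeff_fun_def by (rule exI[of _ 0]) simp

lemma top_coeff_fun_sum:
  assumes "\<And>k. k \<in> I \<Longrightarrow> top_coeff_fun n (a k) (f k)"
  shows "top_coeff_fun n (\<Sum>k\<in>I. a k) (\<lambda>t. \<Sum>k\<in>I. f k t)"
  using assms by (induction I rule: infinite_finite_induct)
    (auto simp: top_coeff_fun_zero intro: top_coeff_fun_add)

lemma top_coeff_fun_prod:
  assumes "\<And>l. l < k \<Longrightarrow> top_coeff_fun n (a l) (f l)"
  shows "top_coeff_fun (k * n) (\<Prod>l<k. a l) (\<lambda>t. \<Prod>l<k. f l t)"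
  using assms
proof (induction k)
  case 0
  show ?case using top_coeff_fun_const[of 1] by simp
next
  case (Suc k)
  then have "top_coeff_fun (k * n + n) ((\<Prod>l<k. a l) * a k) (\<lambda>t. (\<Prod>l<k. f l t) * f k t)"
    by (intro top_coeff_fun_mult) auto
  then show ?case by (simp add: algebra_simps)
qed

lemma degree_coeff_pcompose_linear:
  fixes P :: "int poly"
  assumes "degree P \<le> n"
  shows "degree (pcompose P [:b, c:]) \<le> n \<and> coeff (pcompose P [:b, c:]) n = coeff P n * c ^ n"
  using assms
proof (induction P arbitrary: n)
  case 0
  then show ?case by simp
next
  case (pCons a P)
  show ?case
  proof (cases n)
    case 0
    with pCons.prems have "P = 0" by (auto split: if_splits)
    with 0 show ?thesis by simp
  next
    case (Suc k)
    with pCons.prems have k: "degree P \<le> k" by (auto split: if_splits)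
    note IH = pCons.IH[OF k]
    have d: "degree [:b, c:] \<le> 1" by simp
    have "coeff ([:b, c:] * pcompose P [:b, c:]) (1 + k) = c * (coeff P k * c ^ k)"
      using coeff_mult_top[OF d, of "pcompose P [:b, c:]" k] IH by simp
    moreover have "degree ([:b, c:] * pcompose P [:b, c:]) \<le> 1 + k"
      using degree_mult_le[of "[:b, c:]" "pcompose P [:b, c:]"] d IH by linarith
    moreover have "coeff [:a:] (Suc k) = 0" by simp
    ultimately show ?thesis unfolding Suc pcompose_pCons
      by (intro conjI degree_add_le) (simp_all del: mult_pCons_left)
  qed
qed

lemma top_coeff_fun_linear_substitution:
  assumes "top_coeff_fun n a f"
  shows "top_coeff_fun n (a * c ^ n) (\<lambda>t. f (t * c + b))"
proof -
  from assms obtain P where "degree P \<le> n" "coeff P n = a" "\<forall>t. f t = poly P t"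
    unfolding top_coeff_fun_def by blast
  with degree_coeff_pcompose_linear[of P n b c] show ?thesis unfolding top_coeff_fun_def
    by (intro exI[of _ "pcompose P [:b, c:]"]) (auto simp: poly_pcompose algebra_simps)
qed

lemma finite_residues: "finite {t \<in> {0..<int p}. Q t}"
  by (rule finite_subset[of _ "{0..<int p}"]) auto

text \<open>
  Lagrange's bound for the number of roots in a field, stated for integer representatives: divide by
  \<open>X - r\<close> for a root \<open>r\<close>, which keeps the top coefficient, and use that \<open>p\<close> is prime.
\<close>
lemma card_poly_roots_mod_prime:
  fixes P :: "int poly"
  assumes p: "prime (p::nat)" and "degree P \<le> n" "\<not> int p dvd coeff P n"
  shows "card {t \<in> {0..<int p}. int p dvd poly P t} \<le> n"
  using assms(2,3)
proof (induction n arbitrary: P)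
  case 0
  then obtain a where "P = [:a:]" by (auto elim: degree_eq_zeroE)
  with 0 show ?case by simp
next
  case (Suc n)
  show ?case
  proof (cases "\<exists>r\<in>{0..<int p}. int p dvd poly P r")
    case False
    then have "{t \<in> {0..<int p}. int p dvd poly P t} = {}" by auto
    then show ?thesis by (metis card.empty zero_le)
  next
    case True
    then obtain r where r: "r \<in> {0..<int p}" "int p dvd poly P r" by blast
    define Q where "Q = synthetic_div P r"
    have P: "P = [:-r, 1:] * Q + [:poly P r:]"
      using synthetic_div_correct'[of r P] by (simp add: Q_def)
    have degQ: "degree Q \<le> n" using Suc.prems(1) by (simp add: Q_def degree_synthetic_div)
    have "coeff P (1 + n) = coeff Q n"
      using coeff_mult_top[of "[:-r, 1:]" 1 Q n] degQ by (subst P) (simp del: mult_pCons_left)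
    with Suc.prems(2) have "\<not> int p dvd coeff Q n" by simp
    from Suc.IH[OF degQ this] have IH: "card {t \<in> {0..<int p}. int p dvd poly Q t} \<le> n" .
    have "{t \<in> {0..<int p}. int p dvd poly P t} \<subseteq> insert r {t \<in> {0..<int p}. int p dvd poly Q t}"
    proof
      fix t assume t: "t \<in> {t \<in> {0..<int p}. int p dvd poly P t}"
      have "poly P t = (t - r) * poly Q t + poly P r" by (subst P) (simp add: algebra_simps)
      then have "int p dvd (t - r) * poly Q t" using t r
        by (metis (no_types, lifting) dvd_add_left_iff mem_Collect_eq)
      then have "int p dvd t - r \<or> int p dvd poly Q t" using p by (simp add: prime_dvd_mult_iff)
      moreover have "t = r" if "int p dvd t - r"
      proof (rule ccontr)
        assume "t \<noteq> r"
        with that have "\<bar>int p\<bar> \<le> \<bar>t - r\<bar>" by (intro dvd_imp_le_int) auto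
        with t r show False by auto
      qed
      ultimately show "t \<in> insert r {t \<in> {0..<int p}. int p dvd poly Q t}" using t by auto
    qed
    then have "card {t \<in> {0..<int p}. int p dvd poly P t}
        \<le> card (insert r {t \<in> {0..<int p}. int p dvd poly Q t})"
      by (intro card_mono finite.insertI finite_residues)
    also have "\<dots> \<le> Suc n" using IH finite_residues[of p] by (simp add: card_insert_if del: mem_Collect_eq atLeastLessThan_iff)
    finally show ?thesis .
  qed
qed

lemma card_top_coeff_fun_zeros:
  assumes "prime (p::nat)" "top_coeff_fun n a f" "\<not> int p dvd a"
  shows "card {t \<in> {0..<int p}. int p dvd f t} \<le> n"
proof -
  from assms(2) obtain P where "degree P \<le> n" "coeff P n = a" "\<forall>t. f t = poly P t"
    unfolding top_coeff_fun_def by blast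
  then show ?thesis using card_poly_roots_mod_prime[OF assms(1), of P n] assms(3) by simp
qed


section \<open>Averaging over one coordinate\<close>

text \<open>
  The points of \<open>F\<^sub>p\<^sup>m\<^sup>+\<^sup>1\<close> as functions on indices, so that changing one coordinate is a function update.
\<close>
definition points :: "nat \<Rightarrow> nat \<Rightarrow> (nat \<Rightarrow> int) set" where
  "points p m = PiE {..m} (\<lambda>_. {0..<int p})"

lemma finite_points [simp]: "finite (points p m)"
  unfolding points_def by (intro finite_PiE) auto

lemma card_points: "card (points p m) = p ^ (m + 1)"
  unfolding points_def by (subst card_PiE) auto

lemma points_upd: "x \<in> points p m \<Longrightarrow> i \<le> m \<Longrightarrow> t \<in> {0..<int p} \<Longrightarrow> x(i := t) \<in> points p m"
  unfolding points_def by (auto simp: PiE_iff extensional_def)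

lemma points_range: "x \<in> points p m \<Longrightarrow> i \<le> m \<Longrightarrow> x i \<in> {0..<int p}"
  unfolding points_def by (auto simp: PiE_iff)

text \<open>
  The map exchanging \<open>t\<close> with the coordinate \<open>x i\<close> is an involution on pairs of a point and a residue.
  Resampling a coordinate in this way replaces the decomposition of the space into lines, so all
  counts can stay in the full space.
\<close>
lemma sum_points_average:
  fixes f :: "(nat \<Rightarrow> int) \<Rightarrow> 'a::comm_semiring_1"
  assumes "i \<le> m"
  shows "(\<Sum>x\<in>points p m. \<Sum>t\<in>{0..<int p}. f (x(i := t))) = of_nat p * (\<Sum>x\<in>points p m. f x)"
proof -
  have "(\<Sum>x\<in>points p m. \<Sum>t\<in>{0..<int p}. f (x(i := t)))
      = (\<Sum>(x, t)\<in>points p m \<times> {0..<int p}. f (x(i := t)))"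
    by (simp add: sum.cartesian_product)
  also have "\<dots> = (\<Sum>(x, t)\<in>points p m \<times> {0..<int p}. f x)"
    by (rule sum.reindex_bij_witness[of _ "\<lambda>(x, t). (x(i := t), x i)" "\<lambda>(x, t). (x(i := t), x i)"])
       (use assms in \<open>auto intro!: points_upd dest: points_range\<close>)
  also have "\<dots> = of_nat p * (\<Sum>x\<in>points p m. f x)"
    by (simp add: sum.cartesian_product[symmetric] sum_distrib_left)
  finally show ?thesis .
qed

lemma card_points_fibre_le:
  assumes "i \<le> m" "p > 0" "Q \<subseteq> points p m"
    and D: "\<And>x. x \<in> points p m \<Longrightarrow> card {t \<in> {0..<int p}. x(i := t) \<in> Q} \<le> D"
  shows "card Q \<le> D * p ^ m"
proof -
  have "p * card Q = p * (\<Sum>x\<in>points p m. if x \<in> Q then 1 else 0)"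
    using assms(3) by (simp add: sum.If_cases Int_absorb1)
  also have "\<dots> = (\<Sum>x\<in>points p m. \<Sum>t\<in>{0..<int p}. if x(i := t) \<in> Q then 1 else 0)"
    using sum_points_average[OF assms(1), where f = "\<lambda>x. if x \<in> Q then 1 else (0::nat)" and p = p]
    by simp
  also have "\<dots> = (\<Sum>x\<in>points p m. card {t \<in> {0..<int p}. x(i := t) \<in> Q})"
    by (simp only: card_eq_sum sum.inter_filter[OF finite_atLeastLessThan_int])
  also have "\<dots> \<le> (\<Sum>x\<in>points p m. D)" by (intro sum_mono D)
  also have "\<dots> = p * (D * p ^ m)" by (simp add: card_points)
  finally show ?thesis using \<open>p > 0\<close> by simp
qed


section \<open>Triangular maps and the zeros of their slopes\<close>

text \<open>
  The map \<open>x\<^sub>i \<mapsto> x\<^sub>i G\<^sub>i(x) + H\<^sub>i(x)\<close> over the integers. The data \<open>G\<^sub>i\<close> and \<open>H\<^sub>i\<close> are functions of the coordinates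
  after \<open>i\<close>, both exactly, so that a polynomial in one coordinate can be read off, and modulo \<open>p\<close>, so
  that reducing the orbit at each step does no harm. In the polynomial systems below, the coefficient
  of degree \<open>s\<^sub>i\<close> of \<open>G\<^sub>i\<close>, as a polynomial in the next coordinate, is a unit times a monomial in the
  coordinates after that, so it vanishes modulo \<open>p\<close> only if one of these does.
\<close>
locale triangular_map =
  fixes p m :: nat and s :: "nat \<Rightarrow> nat" and G H :: "nat \<Rightarrow> (nat \<Rightarrow> int) \<Rightarrow> int"
  assumes prime_p: "prime p"
    and G_cong: "\<And>i x y. i \<le> m \<Longrightarrow> (\<And>j. i < j \<Longrightarrow> j \<le> m \<Longrightarrow> x j = y j) \<Longrightarrow> G i x = G i y"
    and H_cong: "\<And>i x y. i \<le> m \<Longrightarrow> (\<And>j. i < j \<Longrightarrow> j \<le> m \<Longrightarrow> x j = y j) \<Longrightarrow> H i x = H i y"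
    and G_mod: "\<And>i x y. i \<le> m \<Longrightarrow> (\<And>j. i < j \<Longrightarrow> j \<le> m \<Longrightarrow> x j mod int p = y j mod int p) \<Longrightarrow>
                  G i x mod int p = G i y mod int p"
    and H_mod: "\<And>i x y. i \<le> m \<Longrightarrow> (\<And>j. i < j \<Longrightarrow> j \<le> m \<Longrightarrow> x j mod int p = y j mod int p) \<Longrightarrow>
                  H i x mod int p = H i y mod int p"
    and G_top: "\<And>i x. i < m \<Longrightarrow> \<exists>a. top_coeff_fun (s i) a (\<lambda>t. G i (x(i + 1 := t))) \<and>
                   (int p dvd a \<longrightarrow> (\<exists>j\<in>{i + 2..m}. int p dvd x j))"
    and G_last: "\<And>x. \<not> int p dvd G m x"
begin

definition T :: "(nat \<Rightarrow> int) \<Rightarrow> nat \<Rightarrow> int" where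
  "T x = (\<lambda>i. x i * G i x + H i x)"

definition slope :: "nat \<Rightarrow> nat \<Rightarrow> (nat \<Rightarrow> int) \<Rightarrow> int" where
  "slope i k x = (\<Prod>l<k. G i ((T ^^ l) x))"

primrec offset :: "nat \<Rightarrow> nat \<Rightarrow> (nat \<Rightarrow> int) \<Rightarrow> int" where
  "offset i 0 x = 0"
| "offset i (Suc k) x = offset i k x * G i ((T ^^ k) x) + H i ((T ^^ k) x)"

text \<open>Iterates stay linear in their own coordinate; hence the names slope and offset.\<close>
lemma iterate_eq: "(T ^^ k) x i = x i * slope i k x + offset i k x"
proof (induction k)
  case 0
  show ?case by (simp add: slope_def)
next
  case (Suc k)
  have "(T ^^ Suc k) x i = (T ^^ k) x i * G i ((T ^^ k) x) + H i ((T ^^ k) x)"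
    by (simp add: T_def[of "(T ^^ k) x"])
  then show ?case by (simp add: Suc slope_def algebra_simps)
qed

lemma iterate_cong:
  assumes "\<And>j. i \<le> j \<Longrightarrow> j \<le> m \<Longrightarrow> x j = y j" "i \<le> j" "j \<le> m"
  shows "(T ^^ k) x j = (T ^^ k) y j"
  using assms(2,3)
proof (induction k arbitrary: j)
  case 0
  then show ?case using assms(1) by simp
next
  case (Suc k)
  have "G j ((T ^^ k) x) = G j ((T ^^ k) y)" "H j ((T ^^ k) x) = H j ((T ^^ k) y)"
    using Suc by (intro G_cong H_cong; simp)+
  then show ?case using Suc
    by (simp add: T_def[of "(T ^^ k) x"] T_def[of "(T ^^ k) y"])
qed

lemma slope_cong:
  assumes "i \<le> m" "\<And>j. i < j \<Longrightarrow> j \<le> m \<Longrightarrow> x j = y j"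
  shows "slope i k x = slope i k y"
proof -
  have "G i ((T ^^ l) x) = G i ((T ^^ l) y)" for l
    using assms iterate_cong[of "Suc i" x y] by (intro G_cong) auto
  then show ?thesis by (simp add: slope_def)
qed

lemma offset_cong:
  assumes "i \<le> m" "\<And>j. i < j \<Longrightarrow> j \<le> m \<Longrightarrow> x j = y j"
  shows "offset i k x = offset i k y"
proof -
  have "G i ((T ^^ l) x) = G i ((T ^^ l) y)" "H i ((T ^^ l) x) = H i ((T ^^ l) y)" for l
    using assms iterate_cong[of "Suc i" x y] by (intro G_cong H_cong; auto)+
  then show ?thesis by (induction k) simp_all
qed

text \<open>
  The points at which the top coefficient of the \<open>l\<close>-th factor of the slope may vanish modulo \<open>p\<close>.
\<close>
definition degenerate :: "nat \<Rightarrow> nat \<Rightarrow> (nat \<Rightarrow> int) \<Rightarrow> bool" where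
  "degenerate i l x \<longleftrightarrow> int p dvd slope (i + 1) l x \<or> (\<exists>j\<in>{i + 2..m}. int p dvd (T ^^ l) x j)"

lemma degenerate_upd:
  assumes "i < m" shows "degenerate i l (x(i + 1 := t)) \<longleftrightarrow> degenerate i l x"
proof -
  have "slope (i + 1) l (x(i + 1 := t)) = slope (i + 1) l x"
    using assms by (intro slope_cong) auto
  moreover have "(T ^^ l) (x(i + 1 := t)) j = (T ^^ l) x j" if "j \<in> {i + 2..m}" for j
    using that by (intro iterate_cong[of "i + 2"]) auto
  ultimately show ?thesis unfolding degenerate_def by auto
qed

text \<open>
  Along the coordinate \<open>i + 1\<close>, the iterate moves linearly in that coordinate with slope
  \<open>slope (i + 1) l x\<close>, while all later coordinates of the iterate stay fixed. Substituting into \<open>G\<^sub>i\<close>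
  multiplies its top coefficient by a power of this slope.
\<close>
lemma G_iterate_top:
  assumes i: "i < m"
  shows "\<exists>a. top_coeff_fun (s i) a (\<lambda>t. G i ((T ^^ l) (x(i + 1 := t)))) \<and> (int p dvd a \<longrightarrow> degenerate i l x)"
proof -
  define z where "z = (T ^^ l) x"
  from G_top[OF i, of z] obtain a where a: "top_coeff_fun (s i) a (\<lambda>t. G i (z(i + 1 := t)))"
    "int p dvd a \<longrightarrow> (\<exists>j\<in>{i + 2..m}. int p dvd z j)" by blast
  define c b where "c = slope (i + 1) l x" and "b = offset (i + 1) l x"
  have "G i ((T ^^ l) (x(i + 1 := t))) = G i (z(i + 1 := t * c + b))" for t
  proof (rule G_cong)
    fix j assume j: "i < j" "j \<le> m"
    show "(T ^^ l) (x(i + 1 := t)) j = (z(i + 1 := t * c + b)) j"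
    proof (cases "j = i + 1")
      case True
      have "slope (i + 1) l (x(i + 1 := t)) = c" "offset (i + 1) l (x(i + 1 := t)) = b"
        unfolding c_def b_def using i by (intro slope_cong offset_cong; auto)+
      then show ?thesis using True by (simp add: iterate_eq)
    next
      case False
      then show ?thesis using j unfolding z_def
        by (simp, intro iterate_cong[of "i + 2"]) auto
    qed
  qed (use i in simp)
  moreover have "top_coeff_fun (s i) (a * c ^ s i) (\<lambda>t. G i (z(i + 1 := t * c + b)))"
    using top_coeff_fun_linear_substitution[OF a(1)] .
  moreover have "degenerate i l x" if "int p dvd a * c ^ s i"
  proof -
    have "int p dvd a \<or> int p dvd c"
      using that prime_p prime_dvd_multD[of "int p" a "c ^ s i"] prime_dvd_power[of "int p" c "s i"]
      by auto
    then show ?thesis using a(2) unfolding degenerate_def c_def z_def by blast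
  qed
  ultimately show ?thesis by auto
qed

text \<open>
  The slope of the \<open>k'\<close>-th iterate has degree at most \<open>k' s\<^sub>i\<close>, so for \<open>s\<^sub>i \<ge> 1\<close> only the last term of the
  combination reaches degree \<open>k s\<^sub>i\<close>.
\<close>
lemma slope_combination_top:
  assumes i: "i < m" and s: "s i \<ge> 1"
  shows "\<exists>a. top_coeff_fun (k * s i) (c k * a) (\<lambda>t. \<Sum>k'\<le>k. c k' * slope i k' (x(i + 1 := t))) \<and>
           (int p dvd a \<longrightarrow> (\<exists>l<k. degenerate i l x))"
proof -
  have "\<forall>l. \<exists>a. top_coeff_fun (s i) a (\<lambda>t. G i ((T ^^ l) (x(i + 1 := t)))) \<and> (int p dvd a \<longrightarrow> degenerate i l x)"
    using G_iterate_top[OF i] by blast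
  from choice[OF this] obtain a where
    a: "\<And>l. top_coeff_fun (s i) (a l) (\<lambda>t. G i ((T ^^ l) (x(i + 1 := t))))"
    "\<And>l. int p dvd a l \<Longrightarrow> degenerate i l x" by blast
  have top: "top_coeff_fun (k' * s i) (\<Prod>l<k'. a l) (\<lambda>t. slope i k' (x(i + 1 := t)))" for k'
    unfolding slope_def by (rule top_coeff_fun_prod) (rule a(1))
  have "top_coeff_fun (k * s i) (\<Sum>k'<k. 0) (\<lambda>t. \<Sum>k'<k. c k' * slope i k' (x(i + 1 := t)))"
    by (rule top_coeff_fun_sum, rule top_coeff_fun_raise[OF top_coeff_fun_cmult[OF top]]) (use s in auto)
  from top_coeff_fun_add[OF this top_coeff_fun_cmult[OF top]]
  have "top_coeff_fun (k * s i) (c k * (\<Prod>l<k. a l)) (\<lambda>t. \<Sum>k'\<le>k. c k' * slope i k' (x(i + 1 := t)))"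
    by (simp add: lessThan_Suc_atMost[symmetric])
  moreover have "\<exists>l<k. degenerate i l x" if "int p dvd (\<Prod>l<k. a l)"
    using that a(2) prime_p by (subst (asm) prime_dvd_prod_iff) auto
  ultimately show ?thesis by blast
qed

lemma p_pos: "p > 0" using prime_p by (simp add: prime_gt_0_nat)

text \<open>
  Away from the degenerate points, a whole line in direction \<open>i + 1\<close> carries a polynomial of degree
  \<open>k s\<^sub>i\<close> that is nonzero modulo \<open>p\<close>. Degeneracy is constant along such lines.
\<close>
lemma card_zeros_combination:
  assumes i: "i < m" and s: "s i \<ge> 1" and c: "\<not> int p dvd c k"
  shows "card {x \<in> points p m. int p dvd (\<Sum>k'\<le>k. c k' * slope i k' x)}
    \<le> k * s i * p ^ m + (\<Sum>l<k. card {x \<in> points p m. degenerate i l x})"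
proof -
  define bad where "bad = (\<Union>l<k. {x \<in> points p m. degenerate i l x})"
  define Q where "Q = {x \<in> points p m. int p dvd (\<Sum>k'\<le>k. c k' * slope i k' x)} - bad"
  have "card Q \<le> k * s i * p ^ m"
  proof (rule card_points_fibre_le)
    fix x assume x: "x \<in> points p m"
    show "card {t \<in> {0..<int p}. x(i + 1 := t) \<in> Q} \<le> k * s i"
    proof (cases "\<exists>l<k. degenerate i l x")
      case True
      then have "{t \<in> {0..<int p}. x(i + 1 := t) \<in> Q} = {}"
        unfolding Q_def bad_def using degenerate_upd[OF i] x i by auto
      then show ?thesis by (metis card.empty zero_le)
    next
      case False
      with slope_combination_top[OF i s] obtain a where
        a: "top_coeff_fun (k * s i) (c k * a) (\<lambda>t. \<Sum>k'\<le>k. c k' * slope i k' (x(i + 1 := t)))"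
        "\<not> int p dvd a" by blast
      have "\<not> int p dvd c k * a" using c a(2) prime_p by (simp add: prime_dvd_mult_iff)
      from card_top_coeff_fun_zeros[OF prime_p a(1) this]
      have "card {t \<in> {0..<int p}. int p dvd (\<Sum>k'\<le>k. c k' * slope i k' (x(i + 1 := t)))} \<le> k * s i" .
      moreover have "card {t \<in> {0..<int p}. x(i + 1 := t) \<in> Q}
          \<le> card {t \<in> {0..<int p}. int p dvd (\<Sum>k'\<le>k. c k' * slope i k' (x(i + 1 := t)))}"
        by (intro card_mono finite_residues) (auto simp: Q_def)
      ultimately show ?thesis by linarith
    qed
  qed (use i p_pos in \<open>auto simp: Q_def\<close>)
  moreover have "card bad \<le> (\<Sum>l<k. card {x \<in> points p m. degenerate i l x})"
    unfolding bad_def by (rule card_UN_le) simp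
  moreover have "card {x \<in> points p m. int p dvd (\<Sum>k'\<le>k. c k' * slope i k' x)} \<le> card (Q \<union> bad)"
    by (intro card_mono) (auto simp: Q_def bad_def)
  moreover have "card (Q \<union> bad) \<le> card Q + card bad" by (rule card_Un_le)
  ultimately show ?thesis by linarith
qed

lemma card_zeros_iterate:
  assumes j: "j \<le> m"
  shows "card {x \<in> points p m. int p dvd (T ^^ l) x j}
    \<le> card {x \<in> points p m. int p dvd slope j l x} + p ^ m"
proof -
  define bad where "bad = {x \<in> points p m. int p dvd slope j l x}"
  define Q where "Q = {x \<in> points p m. int p dvd (T ^^ l) x j} - bad"
  have inv: "slope j l (x(j := t)) = slope j l x" "offset j l (x(j := t)) = offset j l x" for x t
    using j by (intro slope_cong offset_cong; auto)+
  have "card Q \<le> 1 * p ^ m"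
  proof (rule card_points_fibre_le[OF j p_pos])
    fix x assume x: "x \<in> points p m"
    show "card {t \<in> {0..<int p}. x(j := t) \<in> Q} \<le> 1"
    proof (cases "int p dvd slope j l x")
      case True
      then have "{t \<in> {0..<int p}. x(j := t) \<in> Q} = {}"
        unfolding Q_def bad_def using inv x j by auto
      then show ?thesis by (metis card.empty zero_le)
    next
      case False
      have "card {t \<in> {0..<int p}. int p dvd poly [:offset j l x, slope j l x:] t} \<le> 1"
        by (rule card_poly_roots_mod_prime[OF prime_p]) (use False in auto)
      moreover have "card {t \<in> {0..<int p}. x(j := t) \<in> Q}
          \<le> card {t \<in> {0..<int p}. int p dvd poly [:offset j l x, slope j l x:] t}"
        by (intro card_mono finite_residues) (auto simp: Q_def iterate_eq inv algebra_simps)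
      ultimately show ?thesis by linarith
    qed
  qed (auto simp: Q_def)
  moreover have "card {x \<in> points p m. int p dvd (T ^^ l) x j} \<le> card (Q \<union> bad)"
    by (intro card_mono) (auto simp: Q_def bad_def)
  moreover have "card (Q \<union> bad) \<le> card Q + card bad" by (rule card_Un_le)
  ultimately show ?thesis unfolding bad_def by simp
qed

text \<open>
  The constants \<open>E n = (d + 1) 2\<^sup>n\<close> are the solution of \<open>E n = 1 + d + \<Sum>\<^sub>r\<^sub><\<^sub>n E r\<close>, which is what the
  recursion over the later indices produces: \<open>d\<close> from the degree, one \<open>E r\<close> from each later index,
  and \<open>1\<close> for the term \<open>p\<^sup>m\<close> carried on the left. That term is kept there because the zeros of an
  iterate exceed those of its slope by up to \<open>p\<^sup>m\<close>. The exponent of \<open>K\<close> rises by one in each step since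
  the slope has up to \<open>K\<close> factors.
\<close>
lemma zeros_bound_step:
  assumes i: "i < m" and K: "K \<ge> 1" and s: "1 \<le> s i" "s i \<le> d" and c: "\<not> int p dvd c k" and k: "k \<le> K"
    and IH: "\<And>j l. i < j \<Longrightarrow> j \<le> m \<Longrightarrow> l \<le> K \<Longrightarrow>
       card {x \<in> points p m. int p dvd slope j l x} + p ^ m \<le> (d + 1) * 2 ^ (m - j) * K ^ (m - j) * p ^ m"
  shows "card {x \<in> points p m. int p dvd (\<Sum>k'\<le>k. c k' * slope i k' x)} + p ^ m
     \<le> (d + 1) * 2 ^ (m - i) * K ^ (m - i) * p ^ m"
proof -
  define n where "n = m - Suc i"
  have n: "m - i = Suc n" using i by (simp add: n_def)
  have deg: "card {x \<in> points p m. degenerate i l x} \<le> (d + 1) * (2 ^ Suc n - 1) * K ^ n * p ^ m"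
    if l: "l \<le> K" for l
  proof -
      (* Degeneracy concerns only the slope at index i + 1 but the full iterate at all later ones. *)
  define Z where "Z j = (if j = i + 1 then {x \<in> points p m. int p dvd slope j l x}
      else {x \<in> points p m. int p dvd (T ^^ l) x j})" for j
    have Z: "card (Z j) \<le> (d + 1) * 2 ^ (m - j) * K ^ n * p ^ m" if j: "j \<in> {i + 1..m}" for j
    proof -
      have "card (Z j) \<le> card {x \<in> points p m. int p dvd slope j l x} + p ^ m"
        using card_zeros_iterate[of j l] j by (auto simp: Z_def)
      also have "\<dots> \<le> (d + 1) * 2 ^ (m - j) * K ^ (m - j) * p ^ m" using j l by (intro IH) auto
      also have "\<dots> \<le> (d + 1) * 2 ^ (m - j) * K ^ n * p ^ m"
        using K j by (intro mult_mono power_increasing) (use p_pos in \<open>auto simp: n_def\<close>)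
      finally show ?thesis .
    qed
    have "{x \<in> points p m. degenerate i l x} \<subseteq> (\<Union>j\<in>{i + 1..m}. Z j)"
    proof
      fix x assume x: "x \<in> {x \<in> points p m. degenerate i l x}"
      then consider "int p dvd slope (i + 1) l x" | j where "j \<in> {i + 2..m}" "int p dvd (T ^^ l) x j"
        unfolding degenerate_def by blast
      then show "x \<in> (\<Union>j\<in>{i + 1..m}. Z j)"
      proof cases
        case 1
        then have "x \<in> Z (i + 1)" using x by (simp add: Z_def)
        then show ?thesis using i by (intro UN_I[of "i + 1"]) simp_all
      next
        case 2
        then have "x \<in> Z j" using x by (simp add: Z_def)
        then show ?thesis using 2(1) by (intro UN_I[of j]) simp_all
      qed
    qed
    then have "card {x \<in> points p m. degenerate i l x} \<le> card (\<Union>j\<in>{i + 1..m}. Z j)"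
      by (intro card_mono) (auto simp: Z_def)
    also have "\<dots> \<le> (\<Sum>j\<in>{i + 1..m}. card (Z j))" by (rule card_UN_le) simp
    also have "\<dots> \<le> (\<Sum>j\<in>{i + 1..m}. (d + 1) * 2 ^ (m - j) * K ^ n * p ^ m)"
      by (intro sum_mono Z)
    also have "\<dots> = (\<Sum>j\<in>{i + 1..m}. 2 ^ (m - j)) * ((d + 1) * K ^ n * p ^ m)"
      by (simp only: sum_distrib_right) (simp only: mult_ac)
    also have "(\<Sum>j\<in>{i + 1..m}. 2 ^ (m - j)) = (\<Sum>r<Suc n. 2 ^ r :: nat)"
      by (rule sum.reindex_bij_witness[of _ "\<lambda>r. m - r" "\<lambda>j. m - j"]) (use i in \<open>auto simp: n_def\<close>)
    also have "\<dots> = 2 ^ Suc n - 1" by (simp only: sum_power2[symmetric] lessThan_atLeast0)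
    finally show ?thesis by (simp only: mult_ac)
  qed
  define Q where "Q = K ^ Suc n * p ^ m"
  have "card {x \<in> points p m. int p dvd (\<Sum>k'\<le>k. c k' * slope i k' x)}
      \<le> k * s i * p ^ m + (\<Sum>l<k. card {x \<in> points p m. degenerate i l x})"
    by (rule card_zeros_combination[where c = c, OF i s(1) c])
  also have "(\<Sum>l<k. card {x \<in> points p m. degenerate i l x})
      \<le> (\<Sum>l<k. (d + 1) * (2 ^ Suc n - 1) * K ^ n * p ^ m)"
    using k by (intro sum_mono deg) auto
  also have "\<dots> = k * ((d + 1) * (2 ^ Suc n - 1) * K ^ n * p ^ m)" by simp
  also have "\<dots> \<le> K * ((d + 1) * (2 ^ Suc n - 1) * K ^ n * p ^ m)" using k by (intro mult_right_mono) auto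
  also have "\<dots> = (d + 1) * (2 ^ Suc n - 1) * Q" unfolding Q_def by (simp only: mult_ac power_Suc)
  also have "k * s i * p ^ m \<le> K ^ Suc n * d * p ^ m"
  proof -
    have "k \<le> K ^ Suc n" using k K by (metis le_trans self_le_power zero_less_Suc)
    then show ?thesis using s by (intro mult_mono) auto
  qed
  also have "K ^ Suc n * d * p ^ m = d * Q" by (simp add: Q_def)
  finally have "card {x \<in> points p m. int p dvd (\<Sum>k'\<le>k. c k' * slope i k' x)}
    \<le> d * Q + (d + 1) * (2 ^ Suc n - 1) * Q" by simp
  moreover have "p ^ m \<le> Q" unfolding Q_def using K by simp
  moreover have "d * Q + (d + 1) * (2 ^ Suc n - 1) * Q + Q = (d + 1) * 2 ^ Suc n * Q"
  proof -
    obtain e where e: "(2::nat) ^ Suc n = Suc e" by (metis not0_implies_Suc power_not_zero zero_neq_numeral)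
    show ?thesis unfolding e by (simp add: algebra_simps)
  qed
  ultimately show ?thesis unfolding n Q_def by (simp only: mult.assoc)
qed

lemma zeros_bound:
  assumes K: "K \<ge> 1" and s: "\<And>i. i < m \<Longrightarrow> 1 \<le> s i \<and> s i \<le> d"
  shows "i \<le> m \<Longrightarrow> l \<le> K \<Longrightarrow>
       card {x \<in> points p m. int p dvd slope i l x} + p ^ m \<le> (d + 1) * 2 ^ (m - i) * K ^ (m - i) * p ^ m"
proof (induction "m - i" arbitrary: i l rule: less_induct)
  case less
  show ?case
  proof (cases "i = m")
    case True
    have "\<not> int p dvd slope i l x" for x
      unfolding slope_def True using prime_p G_last by (subst prime_dvd_prod_iff) auto
    then have "{x \<in> points p m. int p dvd slope i l x} = {}" by blast
    then have "card {x \<in> points p m. int p dvd slope i l x} = 0" by (metis card.empty)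
    then show ?thesis using True by (simp only: diff_self_eq_0) simp
  next
    case False
    then have i: "i < m" using less.prems by simp
    (* A single slope is the combination with one unit coefficient. *)
    define c where "c k = (if k = l then 1 else (0::int))" for k
    have "c k * z = (if k = l then z else 0)" for k z by (simp add: c_def)
    then have "(\<Sum>k'\<le>l. c k' * slope i k' x) = slope i l x" for x by simp
    moreover have "card {x \<in> points p m. int p dvd (\<Sum>k'\<le>l. c k' * slope i k' x)} + p ^ m
     \<le> (d + 1) * 2 ^ (m - i) * K ^ (m - i) * p ^ m"
    proof (rule zeros_bound_step[where c = c and k = l and d = d and i = i, OF i K])
      show "\<not> int p dvd c l" using prime_p by (auto simp: c_def)
    qed (use s[OF i] less i in auto)
    ultimately show ?thesis by simp
  qed
qed

lemma zeros_combination_bound: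
  assumes K: "K \<ge> 1" and s: "\<And>i. i < m \<Longrightarrow> 1 \<le> s i \<and> s i \<le> d"
    and i: "i < m" and c: "\<not> int p dvd c k" and k: "k \<le> K"
  shows "card {x \<in> points p m. int p dvd (\<Sum>k'\<le>k. c k' * slope i k' x)} \<le> (d + 1) * 2 ^ m * K ^ m * p ^ m"
proof -
  have "card {x \<in> points p m. int p dvd (\<Sum>k'\<le>k. c k' * slope i k' x)} + p ^ m
     \<le> (d + 1) * 2 ^ (m - i) * K ^ (m - i) * p ^ m"
    by (rule zeros_bound_step[OF i K, where c = c, OF _ _ c k]) (use s[OF i] zeros_bound[OF K s] in auto)
  also have "\<dots> \<le> (d + 1) * 2 ^ m * K ^ m * p ^ m"
    using K p_pos by (intro mult_mono power_increasing) auto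
  finally show ?thesis by simp
qed

end


section \<open>Additive characters and moments of exponential sums\<close>

lemma ep_cis: "e\<^sub>p p z = cis (2 * pi * (of_int z / of_nat p))"
  unfolding e\<^sub>p_def cis_conv_exp by (rule arg_cong[where f = exp]) (simp add: algebra_simps)

lemma norm_ep [simp]: "cmod (e\<^sub>p p z) = 1"
  by (simp add: ep_cis)

lemma ep_0 [simp]: "e\<^sub>p p 0 = 1"
  by (simp add: e\<^sub>p_def)

lemma ep_add: "e\<^sub>p p (x + y) = e\<^sub>p p x * e\<^sub>p p y"
  unfolding e\<^sub>p_def by (simp add: exp_add[symmetric] add_divide_distrib algebra_simps)

lemma ep_uminus: "e\<^sub>p p (- x) = cnj (e\<^sub>p p x)"
  by (simp add: ep_cis cis_cnj)

lemma ep_sum: "e\<^sub>p p (\<Sum>i\<in>I. f i) = (\<Prod>i\<in>I. e\<^sub>p p (f i))"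
  by (induction I rule: infinite_finite_induct) (simp_all add: ep_add)

lemma ep_power: "e\<^sub>p p x ^ n = e\<^sub>p p (int n * x)"
  by (induction n) (simp_all add: ep_add algebra_simps)

lemma ep_eq_1_iff:
  assumes "p > 0"
  shows "e\<^sub>p p z = 1 \<longleftrightarrow> int p dvd z"
proof
  assume "int p dvd z"
  then obtain k where "z = int p * k" by (elim dvdE)
  then have "e\<^sub>p p z = cis (2 * pi * of_int k)" using assms by (simp add: ep_cis)
  then show "e\<^sub>p p z = 1" by (simp add: cis_multiple_2pi)
next
  assume "e\<^sub>p p z = 1"
  then have "cos (2 * pi * (of_int z / of_nat p)) = 1"
    unfolding ep_cis by (simp add: complex_eq_iff)
  then obtain k :: int where "2 * pi * (of_int z / of_nat p) = of_int k * 2 * pi"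
    by (auto simp: cos_one_2pi_int)
  then have "(of_int z :: real) = of_int k * of_nat p" using assms by (simp add: field_simps)
  then have "z = k * int p" by (metis of_int_eq_iff of_int_mult of_int_of_nat_eq)
  then show "int p dvd z" by simp
qed

lemma ep_cong:
  assumes "p > 0" "x mod int p = y mod int p"
  shows "e\<^sub>p p x = e\<^sub>p p y"
proof -
  have "int p dvd x - y" using assms(2) by (simp add: mod_eq_dvd_iff)
  then have "e\<^sub>p p (x - y) = 1" using assms(1) by (simp add: ep_eq_1_iff)
  then show ?thesis using ep_add[of p "x - y" y] by simp
qed

text \<open>Orthogonality of the additive characters.\<close>
lemma sum_ep_linear:
  assumes "p > 0"
  shows "(\<Sum>t\<in>{0..<int p}. e\<^sub>p p (t * c)) = (if int p dvd c then of_nat p else 0)"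
proof -
  have "(\<Sum>t\<in>{0..<int p}. e\<^sub>p p (t * c)) = (\<Sum>t<p. e\<^sub>p p c ^ t)"
    by (rule sum.reindex_bij_witness[of _ int nat]) (auto simp: ep_power)
  also have "\<dots> = (if int p dvd c then of_nat p else 0)"
  proof (cases "int p dvd c")
    case True
    then have "e\<^sub>p p c = 1" using assms by (simp add: ep_eq_1_iff)
    then show ?thesis using True by simp
  next
    case False
    then have "e\<^sub>p p c \<noteq> 1" using assms by (simp add: ep_eq_1_iff)
    moreover have "e\<^sub>p p c ^ p = 1" using assms by (simp add: ep_power ep_eq_1_iff)
    ultimately show ?thesis using False by (simp add: geometric_sum)
  qed
  finally show ?thesis .
qed

text \<open>
  Summing over the coordinate in which the phase is linear kills every line on which the coefficient
  \<open>D\<close> is nonzero modulo \<open>p\<close>; the other lines are estimated trivially.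
\<close>
lemma norm_sum_ep_linear_coordinate_le:
  assumes p: "p > 0" and i: "i \<le> m"
    and \<Phi>: "\<And>x t. \<Phi> (x(i := t)) = t * D x + R x"
  shows "cmod (\<Sum>x\<in>points p m. e\<^sub>p p (\<Phi> x)) \<le> card {x \<in> points p m. int p dvd D x}"
proof -
  have "of_nat p * (\<Sum>x\<in>points p m. e\<^sub>p p (\<Phi> x))
      = (\<Sum>x\<in>points p m. \<Sum>t\<in>{0..<int p}. e\<^sub>p p (\<Phi> (x(i := t))))"
    using sum_points_average[OF i, where f = "\<lambda>x. e\<^sub>p p (\<Phi> x)" and p = p] by simp
  also have "\<dots> = (\<Sum>x\<in>points p m. e\<^sub>p p (R x) * (\<Sum>t\<in>{0..<int p}. e\<^sub>p p (t * D x)))"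
    by (simp add: \<Phi> ep_add sum_distrib_left mult.commute)
  also have "\<dots> = (\<Sum>x\<in>points p m. e\<^sub>p p (R x) * (if int p dvd D x then of_nat p else 0))"
    using p by (simp add: sum_ep_linear)
  also have "cmod \<dots> \<le> (\<Sum>x\<in>points p m. cmod (e\<^sub>p p (R x) * (if int p dvd D x then of_nat p else 0)))"
    by (rule norm_sum)
  also have "\<dots> = (\<Sum>x\<in>points p m. if int p dvd D x then real p else 0)"
    by (intro sum.cong) (auto simp: norm_mult)
  also have "\<dots> = real p * card {x \<in> points p m. int p dvd D x}"
    by (simp add: sum.inter_filter[symmetric])
  finally have "real p * cmod (\<Sum>x\<in>points p m. e\<^sub>p p (\<Phi> x)) \<le> real p * card {x \<in> points p m. int p dvd D x}"
    by (simp add: norm_mult)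
  then show ?thesis using p by simp
qed

definition tuples :: "nat \<Rightarrow> nat \<Rightarrow> (nat \<Rightarrow> nat) set" where
  "tuples \<nu> K = PiE {..<\<nu>} (\<lambda>_. {..<K})"

text \<open>
  In the expansion of the moment, the two tuples enter only through this difference of
  multiplicities; it vanishes for all \<open>k\<close> exactly if the tuples agree as multisets.
\<close>
definition excess :: "nat \<Rightarrow> (nat \<Rightarrow> nat) \<Rightarrow> (nat \<Rightarrow> nat) \<Rightarrow> nat \<Rightarrow> int" where
  "excess \<nu> g h k = int (card {j \<in> {..<\<nu>}. g j = k}) - int (card {j \<in> {..<\<nu>}. h j = k})"

lemma finite_tuples [simp]: "finite (tuples \<nu> K)"
  unfolding tuples_def by (intro finite_PiE) auto

lemma card_tuples: "card (tuples \<nu> K) = K ^ \<nu>"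
  unfolding tuples_def by (subst card_PiE) auto

lemma sum_tuple_eq:
  fixes f :: "nat \<Rightarrow> int"
  assumes "g \<in> tuples \<nu> K"
  shows "(\<Sum>j<\<nu>. f (g j)) = (\<Sum>k<K. int (card {j \<in> {..<\<nu>}. g j = k}) * f k)"
proof -
  have "(\<Sum>j<\<nu>. f (g j)) = (\<Sum>j<\<nu>. \<Sum>k<K. if g j = k then f k else 0)"
  proof (intro sum.cong refl)
    fix j assume "j \<in> {..<\<nu>}"
    then have "g j < K" using assms by (auto simp: tuples_def PiE_iff)
    then show "f (g j) = (\<Sum>k<K. if g j = k then f k else 0)" by simp
  qed
  also have "\<dots> = (\<Sum>k<K. \<Sum>j<\<nu>. if g j = k then f k else 0)" by (rule sum.swap)
  also have "\<dots> = (\<Sum>k<K. int (card {j \<in> {..<\<nu>}. g j = k}) * f k)"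
    by (simp only: sum.inter_filter[symmetric, OF finite_lessThan] sum_constant of_nat_id)
  finally show ?thesis .
qed

lemma norm_sum_ep_power:
  "complex_of_real (cmod (\<Sum>k<K. e\<^sub>p p (\<theta> k)) ^ (2 * \<nu>))
     = (\<Sum>(g, h)\<in>tuples \<nu> K \<times> tuples \<nu> K. e\<^sub>p p (\<Sum>k<K. excess \<nu> g h k * \<theta> k))"
proof -
  define z where "z = (\<Sum>k<K. e\<^sub>p p (\<theta> k))"
  have z: "z ^ \<nu> = (\<Sum>g\<in>tuples \<nu> K. e\<^sub>p p (\<Sum>j<\<nu>. \<theta> (g j)))"
  proof -
    have "z ^ \<nu> = (\<Prod>j<\<nu>. \<Sum>k<K. e\<^sub>p p (\<theta> k))" by (simp add: z_def)
    also have "\<dots> = (\<Sum>g\<in>tuples \<nu> K. \<Prod>j<\<nu>. e\<^sub>p p (\<theta> (g j)))"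
      unfolding tuples_def by (rule prod_sum_PiE) auto
    finally show ?thesis by (simp add: ep_sum)
  qed
  have "complex_of_real (cmod z ^ (2 * \<nu>)) = (z * cnj z) ^ \<nu>"
    by (simp add: power_mult complex_norm_square[symmetric] flip: of_real_power)
  also have "\<dots> = z ^ \<nu> * cnj (z ^ \<nu>)" by (simp add: power_mult_distrib)
  also have "\<dots> = (\<Sum>g\<in>tuples \<nu> K. \<Sum>h\<in>tuples \<nu> K.
       e\<^sub>p p (\<Sum>j<\<nu>. \<theta> (g j)) * cnj (e\<^sub>p p (\<Sum>j<\<nu>. \<theta> (h j))))"
    unfolding z by (simp only: cnj_sum sum_product)
  also have "\<dots> = (\<Sum>g\<in>tuples \<nu> K. \<Sum>h\<in>tuples \<nu> K. e\<^sub>p p (\<Sum>k<K. excess \<nu> g h k * \<theta> k))"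
  proof (intro sum.cong refl)
    fix g h assume gh: "g \<in> tuples \<nu> K" "h \<in> tuples \<nu> K"
    have "(\<Sum>k<K. excess \<nu> g h k * \<theta> k) = (\<Sum>j<\<nu>. \<theta> (g j)) + - (\<Sum>j<\<nu>. \<theta> (h j))"
      unfolding sum_tuple_eq[OF gh(1)] sum_tuple_eq[OF gh(2)] excess_def
      by (simp add: left_diff_distrib sum_subtractf)
    then show "e\<^sub>p p (\<Sum>j<\<nu>. \<theta> (g j)) * cnj (e\<^sub>p p (\<Sum>j<\<nu>. \<theta> (h j)))
        = e\<^sub>p p (\<Sum>k<K. excess \<nu> g h k * \<theta> k)"
      by (simp only: ep_add ep_uminus)
  qed
  finally show ?thesis unfolding z_def by (simp only: sum.cartesian_product)
qed

text \<open>
  If the multiplicities agree, every entry of \<open>g\<close> is an entry of \<open>h\<close>, which leaves at most \<open>\<nu>\<^sup>\<nu>\<close> choices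
  of \<open>g\<close> for each \<open>h\<close>.
\<close>
lemma card_balanced_tuples:
  "card {(g, h) \<in> tuples \<nu> K \<times> tuples \<nu> K. \<forall>k<K. excess \<nu> g h k = 0} \<le> \<nu> ^ \<nu> * K ^ \<nu>"
proof -
  have "{(g, h) \<in> tuples \<nu> K \<times> tuples \<nu> K. \<forall>k<K. excess \<nu> g h k = 0}
      \<subseteq> (\<Union>h\<in>tuples \<nu> K. PiE {..<\<nu>} (\<lambda>_. h ` {..<\<nu>}) \<times> {h})"
  proof clarify
    fix g h assume g: "g \<in> tuples \<nu> K" and h: "h \<in> tuples \<nu> K" and e: "\<forall>k<K. excess \<nu> g h k = 0"
    have "g j \<in> h ` {..<\<nu>}" if j: "j < \<nu>" for j
    proof -
      have "g j < K" using g j by (auto simp: tuples_def PiE_iff)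
      then have "card {i \<in> {..<\<nu>}. g i = g j} = card {i \<in> {..<\<nu>}. h i = g j}"
        using e unfolding excess_def by auto
      moreover have "card {i \<in> {..<\<nu>}. g i = g j} > 0" using j by (auto simp: card_gt_0_iff)
      ultimately have "{i \<in> {..<\<nu>}. h i = g j} \<noteq> {}" by (metis card.empty less_nat_zero_code)
      then show ?thesis by force
    qed
    then have "g \<in> PiE {..<\<nu>} (\<lambda>_. h ` {..<\<nu>})" using g by (auto simp: tuples_def PiE_iff)
    then show "(g, h) \<in> (\<Union>h\<in>tuples \<nu> K. PiE {..<\<nu>} (\<lambda>_. h ` {..<\<nu>}) \<times> {h})" using h by blast
  qed
  then have "card {(g, h) \<in> tuples \<nu> K \<times> tuples \<nu> K. \<forall>k<K. excess \<nu> g h k = 0}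
      \<le> card (\<Union>h\<in>tuples \<nu> K. PiE {..<\<nu>} (\<lambda>_. h ` {..<\<nu>}) \<times> {h})"
    by (intro card_mono) (auto intro!: finite_PiE)
  also have "\<dots> \<le> (\<Sum>h\<in>tuples \<nu> K. card (PiE {..<\<nu>} (\<lambda>_. h ` {..<\<nu>}) \<times> {h}))"
    by (rule card_UN_le) simp
  also have "\<dots> \<le> (\<Sum>h\<in>tuples \<nu> K. \<nu> ^ \<nu>)"
  proof (rule sum_mono)
    fix h assume "h \<in> tuples \<nu> K"
    have "card (PiE {..<\<nu>} (\<lambda>_. h ` {..<\<nu>}) \<times> {h}) = card (h ` {..<\<nu>}) ^ \<nu>"
      by (simp add: card_cartesian_product card_PiE)
    also have "\<dots> \<le> \<nu> ^ \<nu>" using card_image_le[of "{..<\<nu>}" h] by (intro power_mono) auto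
    finally show "card (PiE {..<\<nu>} (\<lambda>_. h ` {..<\<nu>}) \<times> {h}) \<le> \<nu> ^ \<nu>" .
  qed
  finally show ?thesis by (simp add: card_tuples mult.commute)
qed

lemma abs_excess_le: "\<bar>excess \<nu> g h k\<bar> \<le> int \<nu>"
proof -
  have "card {j \<in> {..<\<nu>}. f j = k} \<le> \<nu>" for f :: "nat \<Rightarrow> nat"
    using card_mono[of "{..<\<nu>}" "{j \<in> {..<\<nu>}. f j = k}"] by auto
  from this[of g] this[of h] show ?thesis unfolding excess_def by linarith
qed

context triangular_map
begin

definition phase :: "(nat \<Rightarrow> int) \<Rightarrow> nat \<Rightarrow> (nat \<Rightarrow> int) \<Rightarrow> int" where
  "phase a k x = (\<Sum>i<m. a i * (T ^^ k) x i)"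

lemma phase_linear:
  assumes i: "i < m" and a: "\<And>j. j < i \<Longrightarrow> a j = 0"
  shows "phase a k (x(i := t)) = t * (a i * slope i k x) +
    (a i * offset i k x + (\<Sum>j\<in>{i + 1..<m}. a j * (T ^^ k) x j))"
proof -
  have "phase a k (x(i := t)) = (\<Sum>j\<in>{i..<m}. a j * (T ^^ k) (x(i := t)) j)"
    unfolding phase_def by (rule sum.mono_neutral_right) (use a in auto)
  also have "\<dots> = a i * (T ^^ k) (x(i := t)) i + (\<Sum>j\<in>{i + 1..<m}. a j * (T ^^ k) (x(i := t)) j)"
    using i by (simp add: sum.atLeast_Suc_lessThan)
  also have "(T ^^ k) (x(i := t)) i = t * slope i k x + offset i k x"
  proof -
    have "slope i k (x(i := t)) = slope i k x" "offset i k (x(i := t)) = offset i k x"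
      using i by (intro slope_cong offset_cong; auto)+
    then show ?thesis by (simp add: iterate_eq)
  qed
  also have "(\<Sum>j\<in>{i + 1..<m}. a j * (T ^^ k) (x(i := t)) j) = (\<Sum>j\<in>{i + 1..<m}. a j * (T ^^ k) x j)"
  proof (intro sum.cong refl)
    fix j assume "j \<in> {i + 1..<m}"
    then have "(T ^^ k) (x(i := t)) j = (T ^^ k) x j" by (intro iterate_cong[of "i + 1"]) auto
    then show "a j * (T ^^ k) (x(i := t)) j = a j * (T ^^ k) x j" by simp
  qed
  finally show ?thesis by (simp only: distrib_left mult.left_commute[of "a i" t] add.assoc)
qed

text \<open>
  With \<open>i\<close> the first index where \<open>a\<close> is nonzero, the phase is linear in \<open>x\<^sub>i\<close> and its coefficient is \<open>a\<^sub>i\<close>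
  times a combination of slopes. Cutting the combination at its last nonzero coefficient puts it into
  the form required for counting zeros.
\<close>
lemma norm_sum_unbalanced_le:
  assumes K: "K \<ge> 1" and s: "\<And>i. i < m \<Longrightarrow> 1 \<le> s i \<and> s i \<le> d"
    and i: "i < m" and a: "\<And>j. j < i \<Longrightarrow> a j = 0" and ai: "\<not> int p dvd a i"
    and c: "k0 < K" "c k0 \<noteq> 0" "\<And>k. \<bar>c k\<bar> < int p"
  shows "cmod (\<Sum>x\<in>points p m. e\<^sub>p p (\<Sum>k<K. c k * phase a k x)) \<le> (d + 1) * 2 ^ m * K ^ m * p ^ m"
proof -
  define k where "k = Max {k. k < K \<and> c k \<noteq> 0}"
  have ne: "finite {k. k < K \<and> c k \<noteq> 0}" "{k. k < K \<and> c k \<noteq> 0} \<noteq> {}" using c by auto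
  have k: "k < K" "c k \<noteq> 0" using Max_in[OF ne] unfolding k_def by auto
  have kmax: "c k' = 0" if "k' < K" "k < k'" for k'
    using Max_ge[OF ne(1), of k'] that unfolding k_def by fastforce
  have pk: "\<not> int p dvd c k" using k c(3)[of k] zdvd_not_zless[of "\<bar>c k\<bar>" "int p"] by auto
  define D where "D x = (\<Sum>k'\<le>k. c k' * slope i k' x)" for x
  define R where "R x = (\<Sum>k<K. c k * (a i * offset i k x + (\<Sum>j\<in>{i + 1..<m}. a j * (T ^^ k) x j)))" for x
  have "(\<Sum>k<K. c k * phase a k (x(i := t))) = t * (a i * D x) + R x" for x t
  proof -
    have "D x = (\<Sum>k'<K. c k' * slope i k' x)"
      unfolding D_def by (rule sum.mono_neutral_left) (use k kmax in force)+
    then show ?thesis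
      by (simp only: phase_linear[OF i a] R_def distrib_left sum.distrib sum_distrib_left)
         (simp add: algebra_simps)
  qed
  from norm_sum_ep_linear_coordinate_le[OF p_pos _ this] i
  have "cmod (\<Sum>x\<in>points p m. e\<^sub>p p (\<Sum>k<K. c k * phase a k x))
      \<le> card {x \<in> points p m. int p dvd a i * D x}" by simp
  also have "{x \<in> points p m. int p dvd a i * D x} = {x \<in> points p m. int p dvd D x}"
    using prime_p ai by (auto simp: prime_dvd_mult_iff)
  also have "card \<dots> \<le> (d + 1) * 2 ^ m * K ^ m * p ^ m"
    unfolding D_def by (rule zeros_combination_bound[where c = c and k = k, OF K s i pk]) (use k in auto)
  finally show ?thesis by (simp del: of_nat_mult of_nat_add of_nat_power)
qed

text \<open>The balanced pairs of tuples give the first summand, all other pairs the second.\<close>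
lemma moment_bound:
  assumes K: "K \<ge> 1" and s: "\<And>i. i < m \<Longrightarrow> 1 \<le> s i \<and> s i \<le> d"
    and i: "i < m" and a: "\<And>j. j < i \<Longrightarrow> a j = 0" and ai: "\<not> int p dvd a i"
    and \<nu>: "\<nu> < p"
  shows "(\<Sum>x\<in>points p m. cmod (\<Sum>k<K. e\<^sub>p p (phase a k x)) ^ (2 * \<nu>))
     \<le> real (\<nu> ^ \<nu> * K ^ \<nu> * p ^ (m + 1) + K ^ (2 * \<nu>) * ((d + 1) * 2 ^ m * K ^ m * p ^ m))"
proof -
  define P where "P = tuples \<nu> K \<times> tuples \<nu> K"
  define W where "W gh = (\<Sum>x\<in>points p m. e\<^sub>p p (\<Sum>k<K. excess \<nu> (fst gh) (snd gh) k * phase a k x))" for gh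
  define Bal where "Bal = {(g, h) \<in> P. \<forall>k<K. excess \<nu> g h k = 0}"
  have fin: "finite P" "Bal \<subseteq> P" unfolding P_def Bal_def by auto
  have "complex_of_real (\<Sum>x\<in>points p m. cmod (\<Sum>k<K. e\<^sub>p p (phase a k x)) ^ (2 * \<nu>))
      = (\<Sum>x\<in>points p m. \<Sum>gh\<in>P. e\<^sub>p p (\<Sum>k<K. excess \<nu> (fst gh) (snd gh) k * phase a k x))"
    unfolding P_def by (simp only: of_real_sum norm_sum_ep_power case_prod_unfold)
  also have "\<dots> = (\<Sum>gh\<in>P. W gh)" unfolding W_def by (rule sum.swap)
  also have "\<dots> = (\<Sum>gh\<in>Bal. W gh) + (\<Sum>gh\<in>P - Bal. W gh)"
    using fin by (metis sum.subset_diff add.commute)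
  finally have "cmod (complex_of_real (\<Sum>x\<in>points p m. cmod (\<Sum>k<K. e\<^sub>p p (phase a k x)) ^ (2 * \<nu>)))
      \<le> cmod (\<Sum>gh\<in>Bal. W gh) + cmod (\<Sum>gh\<in>P - Bal. W gh)"
    by (metis norm_triangle_ineq)
  also have "cmod (\<Sum>gh\<in>Bal. W gh) \<le> real (card Bal) * real (p ^ (m + 1))"
  proof (rule sum_norm_bound)
    fix gh
    have "cmod (W gh) \<le> (\<Sum>x\<in>points p m. 1)" unfolding W_def by (rule sum_norm_le) simp
    then show "cmod (W gh) \<le> real (p ^ (m + 1))" by (simp add: card_points)
  qed
  also have "real (card Bal) * real (p ^ (m + 1)) \<le> real (\<nu> ^ \<nu> * K ^ \<nu>) * real (p ^ (m + 1))"
    using card_balanced_tuples[of \<nu> K] unfolding Bal_def P_def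
    by (intro mult_right_mono) (simp_all only: of_nat_le_iff of_nat_0_le_iff)
  also have "cmod (\<Sum>gh\<in>P - Bal. W gh) \<le> real (card (P - Bal)) * real ((d + 1) * 2 ^ m * K ^ m * p ^ m)"
  proof (rule sum_norm_bound)
    fix gh assume "gh \<in> P - Bal"
    then have "\<not> (\<forall>k<K. excess \<nu> (fst gh) (snd gh) k = 0)"
      unfolding Bal_def by (simp add: case_prod_unfold)
    then obtain k0 where k0: "k0 < K" "excess \<nu> (fst gh) (snd gh) k0 \<noteq> 0" by blast
    have lt: "\<bar>excess \<nu> (fst gh) (snd gh) k\<bar> < int p" for k
      using abs_excess_le[of \<nu> "fst gh" "snd gh" k] \<nu> by linarith
    show "cmod (W gh) \<le> real ((d + 1) * 2 ^ m * K ^ m * p ^ m)"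
      unfolding W_def by (rule norm_sum_unbalanced_le[where a = a and i = i and ?k0.0 = k0
            and c = "excess \<nu> (fst gh) (snd gh)", OF K s i a ai k0 lt])
  qed
  also have "real (card (P - Bal)) * real ((d + 1) * 2 ^ m * K ^ m * p ^ m)
      \<le> real (K ^ (2 * \<nu>)) * real ((d + 1) * 2 ^ m * K ^ m * p ^ m)"
  proof (intro mult_right_mono)
    have "card (P - Bal) \<le> card P" using fin by (intro card_mono) auto
    also have "card P = K ^ (2 * \<nu>)"
      unfolding P_def by (simp add: card_cartesian_product card_tuples mult_2 power_add)
    finally show "real (card (P - Bal)) \<le> real (K ^ (2 * \<nu>))" by (simp only: of_nat_le_iff)
  qed simp
  finally have "\<bar>\<Sum>x\<in>points p m. cmod (\<Sum>k<K. e\<^sub>p p (phase a k x)) ^ (2 * \<nu>)\<bar>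
     \<le> real (\<nu> ^ \<nu> * K ^ \<nu>) * real (p ^ (m + 1)) + real (K ^ (2 * \<nu>)) * real ((d + 1) * 2 ^ m * K ^ m * p ^ m)"
    by (simp only: norm_of_real)
  then show ?thesis by (simp only: of_nat_mult of_nat_add)
qed

end


section \<open>Evaluating multivariate polynomials at integer points\<close>

definition eval_monom :: "(nat \<Rightarrow>\<^sub>0 nat) \<Rightarrow> (nat \<Rightarrow> int) \<Rightarrow> int" where
  "eval_monom t x = (\<Prod>j\<in>Poly_Mapping.keys t. x j ^ Poly_Mapping.lookup t j)"

definition eval_int :: "mpol \<Rightarrow> (nat \<Rightarrow> int) \<Rightarrow> int" where
  "eval_int P x = (\<Sum>t\<in>Poly_Mapping.keys P. Poly_Mapping.lookup P t * eval_monom t x)"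

lemma eval_mod_eq: "eval_mod p P v = eval_int P (\<lambda>j. v $ j) mod int p"
  by (simp add: eval_mod_def eval_int_def eval_monom_def)

lemma eval_monom_superset:
  assumes "finite I" "Poly_Mapping.keys t \<subseteq> I"
  shows "eval_monom t x = (\<Prod>j\<in>I. x j ^ Poly_Mapping.lookup t j)"
  unfolding eval_monom_def using assms
  by (intro prod.mono_neutral_left) (auto simp: in_keys_iff)

lemma eval_monom_add: "eval_monom (s + t) x = eval_monom s x * eval_monom t x"
proof -
  let ?I = "Poly_Mapping.keys s \<union> Poly_Mapping.keys t"
  have "eval_monom (s + t) x = (\<Prod>j\<in>?I. x j ^ Poly_Mapping.lookup (s + t) j)"
    using keys_add[of s t] by (intro eval_monom_superset) auto
  also have "\<dots> = (\<Prod>j\<in>?I. x j ^ Poly_Mapping.lookup s j) * (\<Prod>j\<in>?I. x j ^ Poly_Mapping.lookup t j)"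
    by (simp add: lookup_add power_add prod.distrib)
  also have "\<dots> = eval_monom s x * eval_monom t x"
    by (simp add: eval_monom_superset[of ?I s] eval_monom_superset[of ?I t])
  finally show ?thesis .
qed

lemma eval_int_superset:
  assumes "finite I" "Poly_Mapping.keys P \<subseteq> I"
  shows "eval_int P x = (\<Sum>t\<in>I. Poly_Mapping.lookup P t * eval_monom t x)"
  unfolding eval_int_def using assms
  by (intro sum.mono_neutral_left) (auto simp: in_keys_iff)

lemma eval_int_add: "eval_int (P + Q) x = eval_int P x + eval_int Q x"
  unfolding eval_int_def by (rule setsum_keys_plus_distrib) (simp_all add: algebra_simps)

lemma eval_int_0 [simp]: "eval_int 0 x = 0"
  by (simp add: eval_int_def)

lemma eval_int_single: "eval_int (Poly_Mapping.single t c) x = c * eval_monom t x"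
  by (simp add: eval_int_def)

lemma poly_mapping_add_single_induct:
  fixes P :: "'a \<Rightarrow>\<^sub>0 'b::comm_monoid_add"
  assumes "R 0" and "\<And>f t c. R f \<Longrightarrow> R (f + Poly_Mapping.single t c)"
  shows "R P"
proof (induction P rule: update_induct)
  case const
  show ?case using assms(1) .
next
  case (update f a b)
  have "Poly_Mapping.update a b f = f + Poly_Mapping.single a b"
    using update(1) by (intro poly_mapping_eqI) (auto simp: lookup_update lookup_add lookup_single in_keys_iff when_def)
  then show ?case using assms(2) update(3) by simp
qed

lemma eval_int_mult: "eval_int (P * Q) x = eval_int P x * eval_int Q x"
proof (induction P rule: poly_mapping_add_single_induct)
  case 1
  show ?case by simp
next
  case (2 P s c)
  have "eval_int (Poly_Mapping.single s c * Q) x = eval_int (Poly_Mapping.single s c) x * eval_int Q x"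
    by (induction Q rule: poly_mapping_add_single_induct)
       (simp_all add: distrib_left eval_int_add mult_single eval_int_single eval_monom_add algebra_simps)
  then show ?case using 2 by (simp add: distrib_right eval_int_add)
qed

lemma lookup_reduce: "Poly_Mapping.lookup (reduce p P) t = Poly_Mapping.lookup P t mod int p"
  unfolding reduce_def by (simp add: Poly_Mapping.map.rep_eq when_def)

lemma eval_int_reduce: "eval_int (reduce p P) x mod int p = eval_int P x mod int p"
proof -
  have "Poly_Mapping.keys (reduce p P) \<subseteq> Poly_Mapping.keys P"
    by (auto simp: in_keys_iff lookup_reduce)
  then have "eval_int (reduce p P) x
      = (\<Sum>t\<in>Poly_Mapping.keys P. Poly_Mapping.lookup P t mod int p * eval_monom t x)"
    by (subst eval_int_superset[of "Poly_Mapping.keys P"]) (auto simp: lookup_reduce)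
  moreover have "[\<dots> = eval_int P x] (mod int p)"
    unfolding eval_int_def by (intro cong_sum cong_mult cong_refl) (simp add: cong_def)
  ultimately show ?thesis by (simp add: cong_def)
qed

lemma eval_int_Var: "eval_int (Var j) x = x j"
  by (simp add: Var_def eval_int_single eval_monom_def)

lemma eval_int_Const: "eval_int (Const c) x = c"
  by (simp add: Const_def eval_int_single eval_monom_def)

lemma prod_Var_power:
  assumes "finite I"
  shows "(\<Prod>j\<in>I. Var j ^ e j) = Poly_Mapping.single (\<Sum>j\<in>I. Poly_Mapping.single j (e j)) 1"
proof -
  have pow: "Var j ^ n = Poly_Mapping.single (Poly_Mapping.single j n) 1" for j n
    by (induction n) (simp_all add: Var_def mult_single single_add[symmetric])
  show ?thesis using assms by (induction I rule: finite_induct) (simp_all add: mult_single pow)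
qed

lemma lookup_sum_single:
  assumes "finite I"
  shows "Poly_Mapping.lookup (\<Sum>j\<in>I. Poly_Mapping.single j (e j)) i = (if i \<in> I then e i else 0::nat)"
  using assms by (simp add: lookup_sum lookup_single when_def)

lemma eval_int_prod_Var:
  assumes "finite I"
  shows "eval_int (\<Prod>j\<in>I. Var j ^ e j) x = (\<Prod>j\<in>I. x j ^ e j)"
proof -
  define t where "t = (\<Sum>j\<in>I. Poly_Mapping.single j (e j))"
  have t: "Poly_Mapping.lookup t j = (if j \<in> I then e j else 0)" for j
    unfolding t_def by (rule lookup_sum_single[OF assms])
  then have "Poly_Mapping.keys t \<subseteq> I" by (auto simp: in_keys_iff split: if_splits)
  then have "eval_monom t x = (\<Prod>j\<in>I. x j ^ e j)"
    by (subst eval_monom_superset[OF assms]) (auto simp: t intro: prod.cong)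
  then show ?thesis using assms by (simp add: prod_Var_power eval_int_single t_def)
qed

lemma eval_int_cong:
  assumes "P \<in> Fp_polys p V" "\<And>j. j \<in> V \<Longrightarrow> x j = y j"
  shows "eval_int P x = eval_int P y"
proof -
  have "x j = y j" if "t \<in> Poly_Mapping.keys P" "j \<in> Poly_Mapping.keys t" for t j
    using assms that by (auto simp: Fp_polys_def)
  then show ?thesis
    unfolding eval_int_def eval_monom_def
    by (intro sum.cong prod.cong arg_cong2[where f = "(*)"] arg_cong2[where f = "(^)"] refl)
qed

lemma eval_int_mod_cong:
  assumes "P \<in> Fp_polys p V" "\<And>j. j \<in> V \<Longrightarrow> x j mod int p = y j mod int p"
  shows "eval_int P x mod int p = eval_int P y mod int p"
  unfolding cong_def[symmetric] eval_int_def eval_monom_def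
  using assms by (intro cong_sum cong_mult cong_prod cong_pow cong_refl) (auto simp: Fp_polys_def cong_def)

lemma lookup_less_deg_in:
  assumes "deg_in j P < ereal (real n)" "t \<in> Poly_Mapping.keys P"
  shows "Poly_Mapping.lookup t j < n"
proof -
  have "ereal (real (Poly_Mapping.lookup t j)) \<le> deg_in j P"
    unfolding deg_in_def using assms(2) by (rule SUP_upper)
  then have "ereal (real (Poly_Mapping.lookup t j)) < ereal (real n)" using assms(1) by (rule le_less_trans)
  then show ?thesis by simp
qed

lemma top_coeff_fun_power: "top_coeff_fun n 1 (\<lambda>t. t ^ n)"
  unfolding top_coeff_fun_def by (rule exI[of _ "monom 1 n"]) (simp add: poly_monom degree_monom_le)

lemma top_coeff_fun_eval_int:
  assumes "deg_in j P < ereal (real n)"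
  shows "top_coeff_fun n 0 (\<lambda>u. eval_int P (x(j := u)))"
proof -
  have "top_coeff_fun n 0 (\<lambda>u. Poly_Mapping.lookup P t * eval_monom t (x(j := u)))"
    if t: "t \<in> Poly_Mapping.keys P" for t
  proof -
    define c where "c = (\<Prod>i\<in>Poly_Mapping.keys t - {j}. x i ^ Poly_Mapping.lookup t i)"
    have "eval_monom t (x(j := u)) = c * u ^ Poly_Mapping.lookup t j" for u
    proof -
      have "eval_monom t (x(j := u)) = (\<Prod>i\<in>insert j (Poly_Mapping.keys t). (x(j := u)) i ^ Poly_Mapping.lookup t i)"
        by (rule eval_monom_superset) auto
      also have "\<dots> = u ^ Poly_Mapping.lookup t j *
          (\<Prod>i\<in>Poly_Mapping.keys t - {j}. (x(j := u)) i ^ Poly_Mapping.lookup t i)"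
        by (subst prod.insert_remove) auto
      also have "(\<Prod>i\<in>Poly_Mapping.keys t - {j}. (x(j := u)) i ^ Poly_Mapping.lookup t i) = c"
        unfolding c_def by (intro prod.cong) auto
      finally show ?thesis by (simp only: mult.commute)
    qed
    moreover have "top_coeff_fun n 0 (\<lambda>u. (Poly_Mapping.lookup P t * c) * u ^ Poly_Mapping.lookup t j)"
      by (rule top_coeff_fun_raise[OF top_coeff_fun_cmult[OF top_coeff_fun_power]]) (rule lookup_less_deg_in[OF assms t])
    ultimately show ?thesis by (simp add: mult.assoc)
  qed
  from top_coeff_fun_sum[of "Poly_Mapping.keys P" n "\<lambda>_. 0", OF this]
  show ?thesis unfolding eval_int_def by simp
qed


section \<open>The polynomial systems as triangular maps\<close>

text \<open>
  The conditions of the locale for one index, so that \<open>G\<^sub>i\<close> and \<open>H\<^sub>i\<close> can be found separately for each \<open>i\<close>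
  and then be chosen simultaneously.
\<close>
definition triangular_step ::
  "nat \<Rightarrow> nat \<Rightarrow> nat \<Rightarrow> nat \<Rightarrow> ((nat \<Rightarrow> int) \<Rightarrow> int) \<Rightarrow> ((nat \<Rightarrow> int) \<Rightarrow> int) \<Rightarrow> bool" where
  "triangular_step p m n i G H \<longleftrightarrow>
     (\<forall>x y. (\<forall>j. i < j \<longrightarrow> j \<le> m \<longrightarrow> x j = y j) \<longrightarrow> G x = G y \<and> H x = H y) \<and>
     (\<forall>x y. (\<forall>j. i < j \<longrightarrow> j \<le> m \<longrightarrow> x j mod int p = y j mod int p) \<longrightarrow>
        G x mod int p = G y mod int p \<and> H x mod int p = H y mod int p) \<and>
     (i < m \<longrightarrow> (\<forall>x. \<exists>a. top_coeff_fun n a (\<lambda>t. G (x(i + 1 := t))) \<and>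
                   (int p dvd a \<longrightarrow> (\<exists>j\<in>{i + 2..m}. int p dvd x j)))) \<and>
     (i = m \<longrightarrow> (\<forall>x. \<not> int p dvd G x))"

lemma not_dvd_residue: "g \<in> Fp p - {0} \<Longrightarrow> \<not> int p dvd g"
  using zdvd_not_zless[of g "int p"] by (auto simp: Fp_def)

text \<open>
  Since \<open>G'\<close> has degree less than \<open>e (i + 1)\<close> in \<open>X\<^sub>i\<^sub>+\<^sub>1\<close>, the coefficient of that degree comes from the
  leading monomial alone.
\<close>
lemma triangular_step_inner:
  assumes p: "prime p" and i: "i < m"
    and G': "G' \<in> Fp_polys p {i + 1..m}" and H: "H \<in> Fp_polys p {i + 1..m}"
    and deg: "deg_in (i + 1) G' < ereal (real (e (i + 1)))" and g: "g \<in> Fp p - {0}"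
  shows "triangular_step p m (e (i + 1)) i
     (\<lambda>x. g * (\<Prod>j\<in>{i + 1..m}. x j ^ e j) + eval_int G' x) (eval_int H)"
proof -
  let ?G = "\<lambda>x. g * (\<Prod>j\<in>{i + 1..m}. x j ^ e j) + eval_int G' x"
  have 1: "?G x = ?G y" "eval_int H x = eval_int H y"
    if "\<forall>j. i < j \<longrightarrow> j \<le> m \<longrightarrow> x j = y j" for x y
  proof -
    have *: "x j = y j" if "j \<in> {i + 1..m}" for j
      using that \<open>\<forall>j. i < j \<longrightarrow> j \<le> m \<longrightarrow> x j = y j\<close> by simp
    show "eval_int H x = eval_int H y" using H * by (rule eval_int_cong)
    have "eval_int G' x = eval_int G' y" using G' * by (rule eval_int_cong)
    moreover have "(\<Prod>j\<in>{i + 1..m}. x j ^ e j) = (\<Prod>j\<in>{i + 1..m}. y j ^ e j)"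
      using * by (intro prod.cong) auto
    ultimately show "?G x = ?G y" by simp
  qed
  have 2: "?G x mod int p = ?G y mod int p" "eval_int H x mod int p = eval_int H y mod int p"
    if "\<forall>j. i < j \<longrightarrow> j \<le> m \<longrightarrow> x j mod int p = y j mod int p" for x y
  proof -
    have *: "x j mod int p = y j mod int p" if "j \<in> {i + 1..m}" for j
      using that \<open>\<forall>j. i < j \<longrightarrow> j \<le> m \<longrightarrow> x j mod int p = y j mod int p\<close> by simp
    show "eval_int H x mod int p = eval_int H y mod int p" using H * by (rule eval_int_mod_cong)
    have "eval_int G' x mod int p = eval_int G' y mod int p" using G' * by (rule eval_int_mod_cong)
    then have "[?G x = ?G y] (mod int p)"
      by (intro cong_add cong_mult cong_prod cong_pow cong_refl) (use * in \<open>auto simp: cong_def\<close>)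
    then show "?G x mod int p = ?G y mod int p" by (simp add: cong_def)
  qed
  have 3: "\<exists>a. top_coeff_fun (e (i + 1)) a (\<lambda>t. ?G (x(i + 1 := t))) \<and>
      (int p dvd a \<longrightarrow> (\<exists>j\<in>{i + 2..m}. int p dvd x j))" for x
  proof -
    define c where "c = g * (\<Prod>j\<in>{i + 2..m}. x j ^ e j)"
    have "g * (\<Prod>j\<in>{i + 1..m}. (x(i + 1 := t)) j ^ e j) = c * t ^ e (i + 1)" for t
    proof -
      have "{i + 1..m} = insert (i + 1) {i + 2..m}" using i by auto
      then have "(\<Prod>j\<in>{i + 1..m}. (x(i + 1 := t)) j ^ e j)
          = t ^ e (i + 1) * (\<Prod>j\<in>{i + 2..m}. (x(i + 1 := t)) j ^ e j)" by simp
      also have "(\<Prod>j\<in>{i + 2..m}. (x(i + 1 := t)) j ^ e j) = (\<Prod>j\<in>{i + 2..m}. x j ^ e j)"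
        by (intro prod.cong) auto
      finally show ?thesis by (simp add: c_def)
    qed
    then have "top_coeff_fun (e (i + 1)) (c * 1 + 0) (\<lambda>t. ?G (x(i + 1 := t)))"
      using top_coeff_fun_add[OF top_coeff_fun_cmult[OF top_coeff_fun_power] top_coeff_fun_eval_int[OF deg]] by simp
    moreover have "\<exists>j\<in>{i + 2..m}. int p dvd x j" if "int p dvd c * 1 + 0"
    proof -
      have "int p dvd (\<Prod>j\<in>{i + 2..m}. x j ^ e j)"
        using that not_dvd_residue[OF g] p by (simp add: c_def prime_dvd_mult_iff)
      then show ?thesis using p by (auto simp: prime_dvd_prod_iff dest: prime_dvd_power[rotated])
    qed
    ultimately show ?thesis by blast
  qed
  show ?thesis unfolding triangular_step_def using 1 2 3 i by blast
qed

lemma poly_system_step: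
  assumes p: "prime p" and F: "F \<in> poly_systems p S m" and i: "i \<le> m"
  shows "\<exists>G H. triangular_step p m (S $$ (i, i + 1)) i G H \<and>
     (\<forall>v. eval_mod p (F i) v = (v $ i * G (\<lambda>j. v $ j) + H (\<lambda>j. v $ j)) mod int p)"
proof (cases "i = m")
  case True
  from F obtain g h where g: "g \<in> Fp p - {0}" and Fm: "F m = reduce p (Const g * Var m + Const h)"
    unfolding poly_systems_def by blast
  have "triangular_step p m (S $$ (i, i + 1)) i (\<lambda>_. g) (\<lambda>_. h)"
    using not_dvd_residue[OF g] True unfolding triangular_step_def by simp
  moreover have "eval_mod p (F i) v = (v $ i * g + h) mod int p" for v
    using True by (simp add: eval_mod_eq Fm eval_int_reduce eval_int_add eval_int_mult eval_int_Var
        eval_int_Const mult.commute)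
  ultimately show ?thesis by blast
next
  case False
  then have i: "i < m" using i by simp
  with F obtain G H where GH: "G \<in> Fp_polys p {i+1..m}" "H \<in> Fp_polys p {i+1..m}"
    and Fi: "F i = reduce p (Var i * G + H)"
    and ex: "\<exists>g \<in> Fp p - {0}. \<exists>G' \<in> Fp_polys p {i+1..m}.
               G = reduce p (Const g * (\<Prod>j\<in>{i+1..m}. Var j ^ (S $$ (i, j))) + G') \<and>
               (\<forall>j\<in>{i+1..m}. deg_in j G' < ereal (real (S $$ (i, j))))"
    unfolding poly_systems_def by blast
  from ex obtain g G' where g: "g \<in> Fp p - {0}" and G': "G' \<in> Fp_polys p {i+1..m}"
    and G: "G = reduce p (Const g * (\<Prod>j\<in>{i+1..m}. Var j ^ (S $$ (i, j))) + G')"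
    and deg: "\<forall>j\<in>{i+1..m}. deg_in j G' < ereal (real (S $$ (i, j)))" by blast
  let ?G = "\<lambda>x. g * (\<Prod>j\<in>{i + 1..m}. x j ^ (S $$ (i, j))) + eval_int G' x"
  have "triangular_step p m (S $$ (i, i + 1)) i ?G (eval_int H)"
    using triangular_step_inner[OF p i G' GH(2), of "\<lambda>j. S $$ (i, j)"] deg g i by simp
  moreover have "eval_mod p (F i) v = (v $ i * ?G (\<lambda>j. v $ j) + eval_int H (\<lambda>j. v $ j)) mod int p" for v
  proof -
    let ?x = "\<lambda>j. v $ j"
    have "[eval_int G ?x = ?G ?x] (mod int p)"
      unfolding cong_def G eval_int_reduce
      by (simp add: eval_int_add eval_int_mult eval_int_Const eval_int_prod_Var)
    then have "[v $ i * eval_int G ?x + eval_int H ?x = v $ i * ?G ?x + eval_int H ?x] (mod int p)"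
      by (intro cong_add cong_mult cong_refl)
    then show ?thesis unfolding eval_mod_eq Fi eval_int_reduce
      by (simp only: eval_int_add eval_int_mult eval_int_Var cong_def)
  qed
  ultimately show ?thesis by blast
qed

lemma poly_system_triangular:
  assumes p: "prime p" and F: "F \<in> poly_systems p S m"
  obtains G H where "triangular_map p m (\<lambda>i. S $$ (i, i + 1)) G H"
    and "\<And>i v. i \<le> m \<Longrightarrow> eval_mod p (F i) v = triangular_map.T G H (\<lambda>j. v $ j) i mod int p"
proof -
  from poly_system_step[OF p F] have "\<forall>i. \<exists>G H. i \<le> m \<longrightarrow> triangular_step p m (S $$ (i, i + 1)) i G H \<and>
     (\<forall>v. eval_mod p (F i) v = (v $ i * G (\<lambda>j. v $ j) + H (\<lambda>j. v $ j)) mod int p)" by blast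
  then obtain G where "\<forall>i. \<exists>H. i \<le> m \<longrightarrow> triangular_step p m (S $$ (i, i + 1)) i (G i) H \<and>
     (\<forall>v. eval_mod p (F i) v = (v $ i * G i (\<lambda>j. v $ j) + H (\<lambda>j. v $ j)) mod int p)"
    by (rule choice[THEN exE])
  then obtain H where GH: "\<forall>i. i \<le> m \<longrightarrow> triangular_step p m (S $$ (i, i + 1)) i (G i) (H i) \<and>
     (\<forall>v. eval_mod p (F i) v = (v $ i * G i (\<lambda>j. v $ j) + H i (\<lambda>j. v $ j)) mod int p)"
    by (rule choice[THEN exE])
  have st: "triangular_step p m (S $$ (i, i + 1)) i (G i) (H i)" if "i \<le> m" for i
    using GH that by blast
  have tri: "triangular_map p m (\<lambda>i. S $$ (i, i + 1)) G H"
  proof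
    fix i :: nat and x y :: "nat \<Rightarrow> int"
    show "prime p" by (rule p)
    show "G i x = G i y" if "i \<le> m" "\<And>j. i < j \<Longrightarrow> j \<le> m \<Longrightarrow> x j = y j"
      using st[OF that(1)] that(2) unfolding triangular_step_def by blast
    show "H i x = H i y" if "i \<le> m" "\<And>j. i < j \<Longrightarrow> j \<le> m \<Longrightarrow> x j = y j"
      using st[OF that(1)] that(2) unfolding triangular_step_def by blast
    show "G i x mod int p = G i y mod int p"
      if "i \<le> m" "\<And>j. i < j \<Longrightarrow> j \<le> m \<Longrightarrow> x j mod int p = y j mod int p"
      using st[OF that(1)] that(2) unfolding triangular_step_def by blast
    show "H i x mod int p = H i y mod int p"
      if "i \<le> m" "\<And>j. i < j \<Longrightarrow> j \<le> m \<Longrightarrow> x j mod int p = y j mod int p"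
      using st[OF that(1)] that(2) unfolding triangular_step_def by blast
    show "\<exists>a. top_coeff_fun (S $$ (i, i + 1)) a (\<lambda>t. G i (x(i + 1 := t))) \<and>
        (int p dvd a \<longrightarrow> (\<exists>j\<in>{i + 2..m}. int p dvd x j))" if "i < m"
      using st[of i] that unfolding triangular_step_def by simp
    show "\<not> int p dvd G m x"
      using st[of m] unfolding triangular_step_def by simp
  qed
  show thesis
  proof (rule that[OF tri])
    fix i v assume "i \<le> m"
    then show "eval_mod p (F i) v = triangular_map.T G H (\<lambda>j. v $ j) i mod int p"
      using GH triangular_map.T_def[OF tri] by simp
  qed
qed

lemma lookup_single_times:
  fixes Q :: mpol
  shows "Poly_Mapping.lookup (Poly_Mapping.single s c * Q) (s + t) = c * Poly_Mapping.lookup Q t"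
  by (induction Q rule: poly_mapping_add_single_induct)
     (simp_all add: distrib_left lookup_add mult_single lookup_single when_def)

text \<open>
  The monomial \<open>X\<^sub>i X\<^sub>i\<^sub>+\<^sub>1\<^bsup>s\<^esup> \<cdots>\<close> survives in \<open>F\<^sub>i\<close>: \<open>H\<close> does not contain \<open>X\<^sub>i\<close>, and all monomials of \<open>G'\<close> have a
  smaller exponent at \<open>X\<^sub>i\<^sub>+\<^sub>1\<close>. This makes the zero counts, which depend on the exponents, uniform in the
  total degree.
\<close>
lemma exponent_le_system_deg:
  assumes F: "F \<in> poly_systems p S m" and i: "i < m"
  shows "ereal (real (S $$ (i, i + 1))) \<le> system_deg m F"
proof -
  from F i obtain G H where GH: "G \<in> Fp_polys p {i+1..m}" "H \<in> Fp_polys p {i+1..m}"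
    and Fi: "F i = reduce p (Var i * G + H)"
    and ex: "\<exists>g \<in> Fp p - {0}. \<exists>G' \<in> Fp_polys p {i+1..m}.
               G = reduce p (Const g * (\<Prod>j\<in>{i+1..m}. Var j ^ (S $$ (i, j))) + G') \<and>
               (\<forall>j\<in>{i+1..m}. deg_in j G' < ereal (real (S $$ (i, j))))"
    unfolding poly_systems_def by blast
  from ex obtain g G' where g: "g \<in> Fp p - {0}"
    and G: "G = reduce p (Const g * (\<Prod>j\<in>{i+1..m}. Var j ^ (S $$ (i, j))) + G')"
    and deg: "\<forall>j\<in>{i+1..m}. deg_in j G' < ereal (real (S $$ (i, j)))" by blast
  define t1 where "t1 = (\<Sum>j\<in>{i+1..m}. Poly_Mapping.single j (S $$ (i, j)))"
  define t0 where "t0 = Poly_Mapping.single i 1 + t1"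
  have t1: "Poly_Mapping.lookup t1 j = (if j \<in> {i+1..m} then S $$ (i, j) else 0)" for j
    unfolding t1_def by (rule lookup_sum_single) simp
  have "t1 \<notin> Poly_Mapping.keys G'"
  proof
    assume "t1 \<in> Poly_Mapping.keys G'"
    from lookup_less_deg_in[OF _ this, of "i + 1" "S $$ (i, i + 1)"] deg i t1[of "i + 1"]
    show False by simp
  qed
  moreover have "Poly_Mapping.lookup (Const g * (\<Prod>j\<in>{i+1..m}. Var j ^ (S $$ (i, j)))) t1 = g"
    unfolding Const_def prod_Var_power[OF finite_atLeastAtMost] t1_def[symmetric]
    by (simp add: mult_single)
  ultimately have "Poly_Mapping.lookup G t1 = g"
    using g by (simp add: G lookup_reduce lookup_add in_keys_iff Fp_def)
  then have "Poly_Mapping.lookup (Var i * G) t0 = g"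
    using lookup_single_times[of "Poly_Mapping.single i 1" 1 G t1] by (simp add: Var_def t0_def)
  moreover have "Poly_Mapping.lookup H t0 = 0"
  proof (rule ccontr)
    assume "Poly_Mapping.lookup H t0 \<noteq> 0"
    then have "Poly_Mapping.keys t0 \<subseteq> {i+1..m}" using GH(2) by (auto simp: Fp_polys_def in_keys_iff)
    moreover have "i \<in> Poly_Mapping.keys t0" by (simp add: in_keys_iff t0_def lookup_add)
    ultimately show False by auto
  qed
  ultimately have "Poly_Mapping.lookup (F i) t0 = g"
    using g by (simp add: Fi lookup_reduce lookup_add Fp_def)
  then have t0: "t0 \<in> Poly_Mapping.keys (F i)" using g by (simp add: in_keys_iff)
  have "S $$ (i, i + 1) = Poly_Mapping.lookup t0 (i + 1)"
    using i t1[of "i + 1"] by (simp add: t0_def lookup_add lookup_single)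
  also have "\<dots> \<le> (\<Sum>j\<in>Poly_Mapping.keys t0. Poly_Mapping.lookup t0 j)"
  proof (cases "i + 1 \<in> Poly_Mapping.keys t0")
    case True
    then show ?thesis by (intro member_le_sum) auto
  next
    case False
    then have "Poly_Mapping.lookup t0 (i + 1) = 0" by (simp only: in_keys_iff) simp
    then show ?thesis by linarith
  qed
  finally have "ereal (real (S $$ (i, i + 1))) \<le> ereal (real (\<Sum>j\<in>Poly_Mapping.keys t0. Poly_Mapping.lookup t0 j))"
    by (simp only: ereal_less_eq of_nat_le_iff)
  also have "\<dots> \<le> total_deg (F i)" unfolding total_deg_def using t0 by (rule SUP_upper)
  also have "\<dots> \<le> system_deg m F" unfolding system_deg_def using i by (intro SUP_upper) auto
  finally show ?thesis .
qed


section \<open>From moments to incomplete sums along an orbit\<close>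

text \<open>
  A coincidence \<open>w i = w j\<close> propagates forward; because the sequence has no preperiod it also reaches
  back to the start, so \<open>j - i\<close> would be a smaller period.
\<close>
lemma purely_periodic_inj_on:
  assumes per: "purely_periodic w \<tau>" and step: "\<And>n. w (Suc n) = f (w n)"
  shows "inj_on w {..<\<tau>}"
proof -
  have neq: "w i \<noteq> w j" if ij: "i < j" "j < \<tau>" for i j
  proof
    assume eq: "w i = w j"
    have shift: "w (i + k) = w (j + k)" for k
      by (induction k) (simp_all add: eq step)
    (* Adding i periods moves any n to at least i, where the coincidence applies. *)
    have mult: "w (n + k * \<tau>) = w n" for n k
    proof (induction k)
      case (Suc k)
      have "w (n + Suc k * \<tau>) = w ((n + k * \<tau>) + \<tau>)" by (simp add: algebra_simps)
      also have "\<dots> = w (n + k * \<tau>)" using per unfolding purely_periodic_def by blast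
      finally show ?case using Suc by simp
    qed simp
    have "w (n + (j - i)) = w n" for n
    proof -
      have "i \<le> i * \<tau>" using ij by (cases \<tau>) auto
      then obtain k where k: "n + i * \<tau> = i + k" by (metis le_add2 le_trans nat_le_iff_add)
      have "w (n + (j - i)) = w (n + (j - i) + i * \<tau>)" by (simp only: mult)
      also have "n + (j - i) + i * \<tau> = j + k" using k ij by linarith
      also have "w (j + k) = w (n + i * \<tau>)" by (simp only: k shift)
      finally show ?thesis by (simp only: mult)
    qed
    then have "\<tau> \<le> j - i" using per ij unfolding purely_periodic_def by simp
    then show False using ij by linarith
  qed
  show ?thesis
  proof (rule inj_onI)
    fix i j assume "i \<in> {..<\<tau>}" "j \<in> {..<\<tau>}" "w i = w j"
    then show "i = j" using neq[of i j] neq[of j i] by (cases i j rule: linorder_cases) auto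
  qed
qed

lemma sum_power_even_le:
  fixes b :: "nat \<Rightarrow> real"
  assumes "N > 0" "n > 0" "even n"
  shows "(\<Sum>i<N. b i) ^ n \<le> real N ^ (n - 1) * (\<Sum>i<N. b i ^ n)"
proof -
  have "convex_on UNIV (\<lambda>x::real. x ^ n)" using assms by (simp add: convex_power_even)
  then have "(\<Sum>i<N. (1 / real N) *\<^sub>R b i) ^ n \<le> (\<Sum>i<N. (1 / real N) * b i ^ n)"
    using assms by (intro convex_on_sum[where f = "\<lambda>x. x ^ n" and C = UNIV]) auto
  then have "(\<Sum>i<N. b i) ^ n / real N ^ n \<le> (\<Sum>i<N. b i ^ n) / real N"
    by (simp add: sum_divide_distrib[symmetric] power_divide)
  then have "(\<Sum>i<N. b i) ^ n \<le> real N ^ n * ((\<Sum>i<N. b i ^ n) / real N)"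
    using assms by (simp add: field_simps)
  also have "\<dots> = real N ^ (n - 1) * (\<Sum>i<N. b i ^ n)"
    using assms by (simp add: power_eq_if[of _ n])
  finally show ?thesis .
qed

lemma norm_sum_shift_diff_le:
  fixes f :: "nat \<Rightarrow> complex"
  assumes "\<And>n. cmod (f n) \<le> 1"
  shows "cmod ((\<Sum>n<N. f n) - (\<Sum>n<N. f (n + k))) \<le> 2 * real k"
proof (induction k)
  case (Suc k)
  have "(\<Sum>n<N. f (n + k)) - (\<Sum>n<N. f (n + Suc k)) = (\<Sum>n<N. f (n + k) - f (Suc n + k))"
    by (simp add: sum_subtractf)
  also have "\<dots> = f k - f (N + k)"
    using sum_lessThan_telescope'[of "\<lambda>n. f (n + k)" N] by simp
  finally have "cmod ((\<Sum>n<N. f (n + k)) - (\<Sum>n<N. f (n + Suc k))) \<le> 1 + 1"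
    using norm_triangle_ineq4[of "f k" "f (N + k)"] assms[of k] assms[of "N + k"] by simp
  then have "cmod (((\<Sum>n<N. f n) - (\<Sum>n<N. f (n + k))) + ((\<Sum>n<N. f (n + k)) - (\<Sum>n<N. f (n + Suc k))))
      \<le> 2 * real k + 2"
    using Suc.IH by (intro norm_triangle_le) linarith
  then show ?case by simp
qed simp

text \<open>
  Shifting the summation range by \<open>k\<close> changes the sum by at most \<open>2k\<close>, which adds up to at most \<open>K\<^sup>2\<close>
  over all shifts.
\<close>
lemma norm_sum_shift_average_le:
  fixes f :: "nat \<Rightarrow> complex"
  assumes "\<And>n. cmod (f n) \<le> 1"
  shows "real K * cmod (\<Sum>n<N. f n) \<le> (\<Sum>n<N. cmod (\<Sum>k<K. f (n + k))) + (real K)\<^sup>2"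
proof -
  define S where "S = (\<Sum>n<N. f n)"
  have "(\<Sum>k<K. S - (\<Sum>n<N. f (n + k))) = of_nat K * S - (\<Sum>k<K. \<Sum>n<N. f (n + k))"
    by (simp add: sum_subtractf)
  also have "(\<Sum>k<K. \<Sum>n<N. f (n + k)) = (\<Sum>n<N. \<Sum>k<K. f (n + k))" by (rule sum.swap)
  finally have "of_nat K * S = (\<Sum>n<N. \<Sum>k<K. f (n + k)) + (\<Sum>k<K. S - (\<Sum>n<N. f (n + k)))" by simp
  then have "cmod (of_nat K * S) \<le> cmod (\<Sum>n<N. \<Sum>k<K. f (n + k)) + cmod (\<Sum>k<K. S - (\<Sum>n<N. f (n + k)))"
    using norm_triangle_ineq by metis
  also have "cmod (\<Sum>n<N. \<Sum>k<K. f (n + k)) \<le> (\<Sum>n<N. cmod (\<Sum>k<K. f (n + k)))" by (rule norm_sum)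
  also have "cmod (\<Sum>k<K. S - (\<Sum>n<N. f (n + k))) \<le> (\<Sum>k<K. 2 * real k)"
    unfolding S_def by (rule sum_norm_le) (rule norm_sum_shift_diff_le[OF assms])
  also have "(\<Sum>k<K. 2 * real k) \<le> (real K)\<^sup>2"
    by (induction K) (simp_all add: power2_eq_square algebra_simps)
  finally show ?thesis by (simp add: norm_mult S_def)
qed

lemma orbit_in_Fp_vec:
  assumes "p > 0" "w0 \<in> Fp_vec p (m + 1)"
  shows "orbit p m F w0 n \<in> Fp_vec p (m + 1)"
proof (cases n)
  case (Suc k)
  then show ?thesis using assms(1) by (auto simp: Fp_vec_def Fp_def eval_mod_def)
qed (use assms in simp)

definition coords :: "nat \<Rightarrow> int vec \<Rightarrow> nat \<Rightarrow> int" where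
  "coords m v = restrict (\<lambda>j. v $ j) {..m}"

lemma coords_in_points: "v \<in> Fp_vec p (m + 1) \<Longrightarrow> coords m v \<in> points p m"
  unfolding coords_def points_def Fp_vec_def Fp_def by (intro restrict_PiE_iff[THEN iffD2]) simp

lemma inj_on_coords: "inj_on (coords m) (Fp_vec p (m + 1))"
proof (rule inj_onI)
  fix u v assume uv: "u \<in> Fp_vec p (m + 1)" "v \<in> Fp_vec p (m + 1)" "coords m u = coords m v"
  then have dim: "dim_vec u = m + 1" "dim_vec v = m + 1"
    unfolding Fp_vec_def by (blast dest: carrier_vecD)+
  show "u = v"
  proof (rule eq_vecI)
    fix l assume "l < dim_vec v"
    then have "l \<le> m" using dim by simp
    then show "u $ l = v $ l" using fun_cong[OF uv(3), of l] by (simp add: coords_def)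
  qed (simp add: dim)
qed

lemma inj_on_coords_orbit:
  assumes "p > 0" "w0 \<in> Fp_vec p (m + 1)" "purely_periodic (orbit p m F w0) \<tau>"
  shows "inj_on (\<lambda>n. coords m (orbit p m F w0 n)) {..<\<tau>}"
proof -
  have "inj_on (orbit p m F w0) {..<\<tau>}"
    using assms(3)
    by (rule purely_periodic_inj_on[where f = "\<lambda>v. vec (m + 1) (\<lambda>i. eval_mod p (F i) v)"]) simp
  then have "inj_on (coords m \<circ> orbit p m F w0) {..<\<tau>}"
    using orbit_in_Fp_vec[OF assms(1,2)] by (intro comp_inj_on inj_on_subset[OF inj_on_coords]) auto
  then show ?thesis by (simp add: o_def)
qed

lemma period_le:
  assumes "p > 0" "w0 \<in> Fp_vec p (m + 1)" "purely_periodic (orbit p m F w0) \<tau>"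
  shows "\<tau> \<le> p ^ (m + 1)"
proof -
  have "(\<lambda>n. coords m (orbit p m F w0 n)) ` {..<\<tau>} \<subseteq> points p m"
    using orbit_in_Fp_vec[OF assms(1,2)] by (auto intro: coords_in_points)
  then have "card {..<\<tau>} \<le> card (points p m)"
    by (intro card_inj_on_le[OF inj_on_coords_orbit[OF assms]]) auto
  then show ?thesis by (simp add: card_points)
qed

context triangular_map
begin

lemma iterate_mod:
  assumes "\<And>j. j \<le> m \<Longrightarrow> x j mod int p = y j mod int p" "j \<le> m"
  shows "(T ^^ k) x j mod int p = (T ^^ k) y j mod int p"
  using assms(2)
proof (induction k arbitrary: j)
  case 0
  then show ?case using assms(1) by simp
next
  case (Suc k)
  have "G j ((T ^^ k) x) mod int p = G j ((T ^^ k) y) mod int p"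
    "H j ((T ^^ k) x) mod int p = H j ((T ^^ k) y) mod int p"
    using Suc by (intro G_mod H_mod; simp)+
  then show ?case using Suc.IH[OF Suc.prems]
    unfolding funpow.simps o_apply T_def[of "(T ^^ k) x"] T_def[of "(T ^^ k) y"]
    by (intro mod_add_cong mod_mult_cong)
qed

text \<open>
  The orbit is reduced modulo \<open>p\<close> in every step, the iterates of the integer map never are.
\<close>
lemma orbit_iterate:
  assumes F: "\<And>i v. i \<le> m \<Longrightarrow> eval_mod p (F i) v = T (\<lambda>j. v $ j) i mod int p" and "j \<le> m"
  shows "orbit p m F w0 (n + k) $ j mod int p = (T ^^ k) (\<lambda>j. orbit p m F w0 n $ j) j mod int p"
  using assms(2)
proof (induction k arbitrary: j)
  case (Suc k)
  have "orbit p m F w0 (n + Suc k) $ j mod int p = T (\<lambda>j. orbit p m F w0 (n + k) $ j) j mod int p"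
    using Suc.prems F[of j] by simp
  also have "\<dots> = (T ^^ 1) (\<lambda>j. orbit p m F w0 (n + k) $ j) j mod int p" by simp
  also have "\<dots> = (T ^^ 1) ((T ^^ k) (\<lambda>j. orbit p m F w0 n $ j)) j mod int p"
    using Suc.IH Suc.prems by (intro iterate_mod) auto
  finally show ?case by simp
qed simp

text \<open>
  The first \<open>N \<le> \<tau>\<close> points of the orbit are distinct and all summands are nonnegative, so the sum can be
  extended to the whole space.
\<close>
lemma orbit_moment_le:
  assumes F: "\<And>i v. i \<le> m \<Longrightarrow> eval_mod p (F i) v = T (\<lambda>j. v $ j) i mod int p"
    and w0: "w0 \<in> Fp_vec p (m + 1)"
    and per: "purely_periodic (orbit p m F w0) \<tau>" and N: "N \<le> \<tau>"
  shows "(\<Sum>n<N. cmod (\<Sum>k<K. e\<^sub>p p (\<Sum>i<m. a i * orbit p m F w0 (n + k) $ i)) ^ r)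
    \<le> (\<Sum>x\<in>points p m. cmod (\<Sum>k<K. e\<^sub>p p (phase a k x)) ^ r)"
proof -
  define pt where "pt n = coords m (orbit p m F w0 n)" for n
  have pt: "pt n \<in> points p m" for n
    unfolding pt_def by (intro coords_in_points orbit_in_Fp_vec p_pos w0)
  have e: "e\<^sub>p p (\<Sum>i<m. a i * orbit p m F w0 (n + k) $ i) = e\<^sub>p p (phase a k (pt n))" for n k
  proof (rule ep_cong[OF p_pos])
    have "orbit p m F w0 (n + k) $ i mod int p = (T ^^ k) (pt n) i mod int p" if i: "i < m" for i
    proof -
      have "orbit p m F w0 (n + k) $ i mod int p = (T ^^ k) (\<lambda>j. orbit p m F w0 n $ j) i mod int p"
        using orbit_iterate[OF F] i by simp
      also have "(T ^^ k) (\<lambda>j. orbit p m F w0 n $ j) i = (T ^^ k) (pt n) i"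
        by (rule iterate_cong[of i]) (use i in \<open>auto simp: pt_def coords_def\<close>)
      finally show ?thesis .
    qed
    then have "[(\<Sum>i<m. a i * orbit p m F w0 (n + k) $ i) = phase a k (pt n)] (mod int p)"
      unfolding phase_def by (intro cong_sum cong_mult cong_refl) (simp add: cong_def)
    then show "(\<Sum>i<m. a i * orbit p m F w0 (n + k) $ i) mod int p = phase a k (pt n) mod int p"
      by (simp add: cong_def)
  qed
  have inj: "inj_on pt {..<N}"
    unfolding pt_def by (rule inj_on_subset[OF inj_on_coords_orbit[OF p_pos w0 per]]) (use N in auto)
  have "(\<Sum>n<N. cmod (\<Sum>k<K. e\<^sub>p p (\<Sum>i<m. a i * orbit p m F w0 (n + k) $ i)) ^ r)
      = (\<Sum>x\<in>pt ` {..<N}. cmod (\<Sum>k<K. e\<^sub>p p (phase a k x)) ^ r)"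
    using inj by (simp add: sum.reindex e)
  also have "\<dots> \<le> (\<Sum>x\<in>points p m. cmod (\<Sum>k<K. e\<^sub>p p (phase a k x)) ^ r)"
    by (rule sum_mono2) (use pt in auto)
  finally show ?thesis .
qed

end

section \<open>Optimising the number of shifts\<close>

lemma alpha_eq:
  assumes "m \<ge> 1" "\<nu> \<ge> 1"
  shows "\<alpha> m \<nu> = (real m + 1) / (2 * real \<nu>) - 1 / (2 * (real m + real \<nu>))"
  using assms unfolding \<alpha>_def by (simp add: divide_simps power2_eq_square) (simp add: algebra_simps)

text \<open>
  For \<open>N \<le> p\<close> this turns the trivial bound \<open>N = N\<^bsup>1-\<beta>\<^esup> N\<^bsup>\<beta>\<^esup>\<close> into the bound of the theorem.
\<close>
lemma beta_le_alpha:
  assumes "m \<ge> 1" "\<nu> \<ge> 1"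
  shows "\<beta> m \<nu> \<le> \<alpha> m \<nu>"
proof -
  have "1 / (2 * (real m + real \<nu>)) \<le> 1 / (2 * real \<nu>)" using assms by (simp add: frac_le)
  moreover have "1 / (2 * real \<nu>) + 1 / (2 * real \<nu>) \<le> (real m + 1) / (2 * real \<nu>)"
    using assms by (simp add: divide_simps)
  ultimately show ?thesis using assms by (simp add: alpha_eq \<beta>_def)
qed

lemma number_of_shifts:
  assumes "p > 0" "m \<ge> 1" "\<nu> \<ge> 1"
  obtains K :: nat where "K \<ge> 1" "real p powr (1 / real (m + \<nu>)) \<le> real K"
    "real K \<le> 2 * real p powr (1 / real (m + \<nu>))" "real K ^ (m + \<nu>) \<le> 2 ^ (m + \<nu>) * real p"
proof -
  define \<kappa> where "\<kappa> = real p powr (1 / real (m + \<nu>))"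
  define K where "K = nat \<lceil>\<kappa>\<rceil>"
  have \<kappa>: "\<kappa> \<ge> 1" using assms unfolding \<kappa>_def by (intro ge_one_powr_ge_zero) auto
  have K: "\<kappa> \<le> real K" "real K \<le> 2 * \<kappa>" "K \<ge> 1" using \<kappa> unfolding K_def by linarith+
  have "\<kappa> ^ (m + \<nu>) = real p"
    using assms by (simp add: \<kappa>_def powr_realpow[symmetric] powr_powr)
  then have "real K ^ (m + \<nu>) \<le> 2 ^ (m + \<nu>) * real p"
    using power_mono[OF K(2), of "m + \<nu>"] by (simp add: power_mult_distrib)
  with K show thesis using that[of K] unfolding \<kappa>_def by blast
qed

text \<open>
  Dividing by \<open>K\<close> leaves a factor \<open>K\<^bsup>-1/2\<^esup> \<le> p\<^bsup>-1/(2(m+\<nu>))\<^esup>\<close> next to \<open>p\<^bsup>(m+1)/(2\<nu>)\<^esup>\<close>, and the exponents add up to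
  \<open>\<alpha>\<close>. The error \<open>K\<close> from the shifts is absorbed when \<open>N > p\<close>, because then \<open>N\<^bsup>1-\<beta>\<^esup> \<ge> p\<^bsup>1/2\<^esup>\<close> and
  \<open>K \<le> 2 p\<^bsup>1/2\<^esup>\<close>.
\<close>
lemma optimised_estimate:
  fixes X W :: real
  assumes m: "m \<ge> 1" and \<nu>: "\<nu> \<ge> 1" and p: "p > 0" and N: "N > 0" and K: "K \<ge> 1"
    and K1: "real p powr (1 / real (m + \<nu>)) \<le> real K"
    and K2: "real K \<le> 2 * real p powr (1 / real (m + \<nu>))"
    and C: "C \<ge> 0"
    and W: "W \<ge> 0" "W ^ (2 * \<nu>) \<le> real N ^ (2 * \<nu> - 1) * (C * real K ^ \<nu> * real p ^ (m + 1))"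
    and X: "real K * X \<le> W + (real K)\<^sup>2" "X \<le> real N"
  shows "X \<le> (C powr (1 / (2 * real \<nu>)) + 2) * real N powr (1 - \<beta> m \<nu>) * real p powr (\<alpha> m \<nu>)"
proof -
  define Y where "Y = real N powr (1 - \<beta> m \<nu>) * real p powr (\<alpha> m \<nu>)"
  have Y0: "Y \<ge> 0" by (simp add: Y_def)
  have \<alpha>0: "\<alpha> m \<nu> \<ge> 0" using beta_le_alpha[OF m \<nu>] order.trans[of 0 "\<beta> m \<nu>"] by (simp add: \<beta>_def)
  have C0: "C powr (1 / (2 * real \<nu>)) \<ge> 0" by simp
  show ?thesis
  proof (cases "N \<le> p")
    case True
    have "real N = real N powr (1 - \<beta> m \<nu>) * real N powr (\<beta> m \<nu>)"
      using N by (simp add: powr_add[symmetric])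
    also have "\<dots> \<le> real N powr (1 - \<beta> m \<nu>) * real p powr (\<alpha> m \<nu>)"
    proof (rule mult_left_mono)
      have "real N powr (\<beta> m \<nu>) \<le> real p powr (\<beta> m \<nu>)"
        using True by (intro powr_mono2) (auto simp: \<beta>_def)
      also have "\<dots> \<le> real p powr (\<alpha> m \<nu>)" using p beta_le_alpha[OF m \<nu>] by (intro powr_mono) auto
      finally show "real N powr (\<beta> m \<nu>) \<le> real p powr (\<alpha> m \<nu>)" .
    qed simp
    finally have "X \<le> 1 * Y" using X(2) by (simp add: Y_def)
    also have "\<dots> \<le> (C powr (1 / (2 * real \<nu>)) + 2) * Y" using Y0 C0 by (intro mult_right_mono) auto
    finally show ?thesis by (simp add: Y_def mult.assoc)
  next
    case False
    have \<nu>2: "2 * real \<nu> > 0" using \<nu> by simp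
    have pK: "real K > 0" "real p > 0" "real N > 0" using K p N by auto
    have "W = (W powr real (2 * \<nu>)) powr (1 / (2 * real \<nu>))"
      using W(1) \<nu> by (simp add: powr_powr)
    also have "W powr real (2 * \<nu>) = W ^ (2 * \<nu>)"
      using W(1) \<nu> by (subst powr_realpow') auto
    also have "(W ^ (2 * \<nu>)) powr (1 / (2 * real \<nu>))
        \<le> (real N ^ (2 * \<nu> - 1) * (C * real K ^ \<nu> * real p ^ (m + 1))) powr (1 / (2 * real \<nu>))"
      using W by (intro powr_mono2) auto
    also have "\<dots> = (real N ^ (2 * \<nu> - 1)) powr (1 / (2 * real \<nu>)) * (C powr (1 / (2 * real \<nu>)) *
        (real K ^ \<nu>) powr (1 / (2 * real \<nu>)) * (real p ^ (m + 1)) powr (1 / (2 * real \<nu>)))"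
      using C by (simp add: powr_mult)
    also have "(real N ^ (2 * \<nu> - 1)) powr (1 / (2 * real \<nu>)) = real N powr (1 - \<beta> m \<nu>)"
    proof -
      have "real (2 * \<nu> - 1) * (1 / (2 * real \<nu>)) = 1 - \<beta> m \<nu>"
        using \<nu> by (simp add: \<beta>_def of_nat_diff field_simps)
      then show ?thesis using pK by (simp only: powr_realpow[symmetric] powr_powr)
    qed
    also have "(real K ^ \<nu>) powr (1 / (2 * real \<nu>)) = real K powr (1 / 2)"
      using \<nu> pK by (simp add: powr_realpow[symmetric] powr_powr)
    also have "(real p ^ (m + 1)) powr (1 / (2 * real \<nu>)) = real p powr ((real m + 1) / (2 * real \<nu>))"
    proof -
      have "real (m + 1) * (1 / (2 * real \<nu>)) = (real m + 1) / (2 * real \<nu>)" by simp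
      then show ?thesis using pK by (simp only: powr_realpow[symmetric] powr_powr)
    qed
    finally have W': "W \<le> real N powr (1 - \<beta> m \<nu>) * (C powr (1 / (2 * real \<nu>)) * real K powr (1 / 2) *
        real p powr ((real m + 1) / (2 * real \<nu>)))" .
    have "X \<le> W / real K + real K"
      using X(1) pK by (simp add: field_simps power2_eq_square)
    also have "W / real K \<le> C powr (1 / (2 * real \<nu>)) * Y"
    proof -
      have "W / real K \<le> real N powr (1 - \<beta> m \<nu>) * (C powr (1 / (2 * real \<nu>)) * real K powr (1 / 2) *
        real p powr ((real m + 1) / (2 * real \<nu>))) / real K"
        using W' pK by (intro divide_right_mono) auto
      also have "\<dots> = C powr (1 / (2 * real \<nu>)) * real N powr (1 - \<beta> m \<nu>) *
          (real K powr (1 / 2) / real K powr 1) * real p powr ((real m + 1) / (2 * real \<nu>))"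
        using pK by simp
      also have "real K powr (1 / 2) / real K powr 1 = real K powr (- (1 / 2))"
        by (simp only: powr_diff[symmetric]) simp
      also have "C powr (1 / (2 * real \<nu>)) * real N powr (1 - \<beta> m \<nu>) *
          real K powr (- (1 / 2)) * real p powr ((real m + 1) / (2 * real \<nu>))
        \<le> C powr (1 / (2 * real \<nu>)) * real N powr (1 - \<beta> m \<nu>) *
          (real p powr (1 / real (m + \<nu>))) powr (- (1 / 2)) * real p powr ((real m + 1) / (2 * real \<nu>))"
        using K1 pK by (intro mult_right_mono mult_left_mono powr_mono2') auto
      also have "\<dots> = C powr (1 / (2 * real \<nu>)) * real N powr (1 - \<beta> m \<nu>) *
          real p powr (- (1 / (2 * (real m + real \<nu>))) + (real m + 1) / (2 * real \<nu>))"
        by (simp only: powr_powr powr_add mult.assoc) (simp add: algebra_simps)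
      also have "- (1 / (2 * (real m + real \<nu>))) + (real m + 1) / (2 * real \<nu>) = \<alpha> m \<nu>"
        by (simp add: alpha_eq[OF m \<nu>])
      finally show ?thesis by (simp add: Y_def mult.assoc)
    qed
    also have "real K \<le> 2 * Y"
    proof -
      have "real p powr (1 / real (m + \<nu>)) \<le> real p powr (1 - \<beta> m \<nu>)"
      proof (rule powr_mono)
        have "1 / real (m + \<nu>) \<le> 1 / 2" using m \<nu> by (intro divide_left_mono) auto
        moreover have "\<beta> m \<nu> \<le> 1 / 2" using \<nu> by (simp add: \<beta>_def)
        ultimately show "1 / real (m + \<nu>) \<le> 1 - \<beta> m \<nu>" by linarith
      qed (use p in simp)
      also have "\<dots> \<le> real N powr (1 - \<beta> m \<nu>)"
        using False \<nu> by (intro powr_mono2) (auto simp: \<beta>_def field_simps)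
      also have "\<dots> \<le> Y"
      proof -
        have "1 \<le> real p powr (\<alpha> m \<nu>)" using p \<alpha>0 by (intro ge_one_powr_ge_zero) auto
        then show ?thesis unfolding Y_def by (simp add: mult_le_cancel_left1)
      qed
      finally show ?thesis using K2 by linarith
    qed
    finally show ?thesis by (simp add: Y_def algebra_simps)
  qed
qed

text \<open>
  The inequality \<open>K\<^bsup>m+\<nu>\<^esup> \<le> 2\<^bsup>m+\<nu>\<^esup> p\<close> brings both parts of the moment to the size \<open>K\<^bsup>\<nu>\<^esup> p\<^bsup>m+1\<^esup>\<close>.
\<close>
lemma (in triangular_map) orbit_sum_bound:
  assumes F: "\<And>i v. i \<le> m \<Longrightarrow> eval_mod p (F i) v = T (\<lambda>j. v $ j) i mod int p"
    and w0: "w0 \<in> Fp_vec p (m + 1)"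
    and per: "purely_periodic (orbit p m F w0) \<tau>" and N: "0 < N" "N \<le> \<tau>"
    and s: "\<And>i. i < m \<Longrightarrow> 1 \<le> s i \<and> s i \<le> d"
    and i: "i < m" and a: "\<And>j. j < i \<Longrightarrow> a j = 0" and ai: "\<not> int p dvd a i"
    and \<nu>: "1 \<le> \<nu>" "\<nu> < p"
  shows "cmod (\<Sum>n<N. e\<^sub>p p (\<Sum>i<m. a i * orbit p m F w0 n $ i))
    \<le> ((real (\<nu> ^ \<nu>) + real ((d + 1) * 2 ^ m * 2 ^ (m + \<nu>))) powr (1 / (2 * real \<nu>)) + 2)
       * real N powr (1 - \<beta> m \<nu>) * real p powr (\<alpha> m \<nu>)"
proof -
  define f where "f n = e\<^sub>p p (\<Sum>i<m. a i * orbit p m F w0 n $ i)" for n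
  have m: "m \<ge> 1" using i by simp
  obtain K :: nat where K: "K \<ge> 1" "real p powr (1 / real (m + \<nu>)) \<le> real K"
    "real K \<le> 2 * real p powr (1 / real (m + \<nu>))" "real K ^ (m + \<nu>) \<le> 2 ^ (m + \<nu>) * real p"
    using number_of_shifts[OF p_pos m \<nu>(1)] by blast
  define W where "W = (\<Sum>n<N. cmod (\<Sum>k<K. f (n + k)))"
  define C where "C = real (\<nu> ^ \<nu>) + real ((d + 1) * 2 ^ m * 2 ^ (m + \<nu>))"
  have "(\<Sum>n<N. cmod (\<Sum>k<K. f (n + k)) ^ (2 * \<nu>))
      \<le> (\<Sum>x\<in>points p m. cmod (\<Sum>k<K. e\<^sub>p p (phase a k x)) ^ (2 * \<nu>))"
    unfolding f_def by (rule orbit_moment_le[OF F w0 per N(2)])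
  also have "\<dots> \<le> real (\<nu> ^ \<nu> * K ^ \<nu> * p ^ (m + 1) + K ^ (2 * \<nu>) * ((d + 1) * 2 ^ m * K ^ m * p ^ m))"
    by (rule moment_bound[where a = a and i = i, OF K(1) s i a ai \<nu>(2)])
  also have "\<dots> = real (\<nu> ^ \<nu>) * real K ^ \<nu> * real p ^ (m + 1)
      + real ((d + 1) * 2 ^ m) * real K ^ \<nu> * real p ^ m * real K ^ (m + \<nu>)"
    by (simp add: power_add mult_2)
  also have "\<dots> \<le> real (\<nu> ^ \<nu>) * real K ^ \<nu> * real p ^ (m + 1)
      + real ((d + 1) * 2 ^ m) * real K ^ \<nu> * real p ^ m * (2 ^ (m + \<nu>) * real p)"
    using K(4) by (intro add_left_mono mult_left_mono) auto
  also have "\<dots> = C * real K ^ \<nu> * real p ^ (m + 1)"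
    by (simp add: C_def algebra_simps)
  finally have M: "(\<Sum>n<N. cmod (\<Sum>k<K. f (n + k)) ^ (2 * \<nu>)) \<le> C * real K ^ \<nu> * real p ^ (m + 1)" .
  have "W ^ (2 * \<nu>) \<le> real N ^ (2 * \<nu> - 1) * (\<Sum>n<N. cmod (\<Sum>k<K. f (n + k)) ^ (2 * \<nu>))"
    unfolding W_def using N \<nu> by (intro sum_power_even_le) auto
  also have "\<dots> \<le> real N ^ (2 * \<nu> - 1) * (C * real K ^ \<nu> * real p ^ (m + 1))"
    using M by (intro mult_left_mono) auto
  finally have W: "W ^ (2 * \<nu>) \<le> real N ^ (2 * \<nu> - 1) * (C * real K ^ \<nu> * real p ^ (m + 1))" .
  have "real K * cmod (\<Sum>n<N. f n) \<le> W + (real K)\<^sup>2"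
    unfolding W_def by (rule norm_sum_shift_average_le) (simp add: f_def)
  moreover have "cmod (\<Sum>n<N. f n) \<le> real N"
    using sum_norm_le[of "{..<N}" f "\<lambda>_. 1"] by (simp add: f_def)
  moreover have "W \<ge> 0" unfolding W_def by (intro sum_nonneg) simp
  moreover have "C \<ge> 0" by (simp add: C_def)
  ultimately show ?thesis
    using optimised_estimate[OF m \<nu>(1) p_pos N(1) K(1-3) _ _ W] unfolding f_def C_def by blast
qed

lemma nonzero_Fp_vec_first_entry:
  assumes "a \<in> Fp_vec p m" "a \<noteq> 0\<^sub>v m"
  obtains i where "i < m" "\<And>j. j < i \<Longrightarrow> a $ j = 0" "\<not> int p dvd a $ i"
proof -
  have "\<exists>i. i < m \<and> a $ i \<noteq> 0"
  proof (rule ccontr)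
    assume "\<not> (\<exists>i. i < m \<and> a $ i \<noteq> 0)"
    then have "a = 0\<^sub>v m" using assms(1) by (intro eq_vecI) (auto simp: Fp_vec_def)
    then show False using assms(2) by simp
  qed
  then obtain i where i: "i < m" "a $ i \<noteq> 0" and min: "\<And>j. j < i \<Longrightarrow> \<not> (j < m \<and> a $ j \<noteq> 0)"
    using exists_least_iff[of "\<lambda>i. i < m \<and> a $ i \<noteq> 0"] by blast
  have "a $ i \<in> Fp p - {0}" using i assms(1) by (simp add: Fp_vec_def)
  then have "\<not> int p dvd a $ i" by (rule not_dvd_residue)
  then show thesis using that[of i] i(1) min by fastforce
qed

theorem theorem4:
  fixes d m \<nu> :: nat
  assumes "m \<ge> 1" and "d \<ge> 2" and "\<nu> \<ge> 1"
  shows "\<exists>c>0::real. \<forall>(p::nat) (S::nat mat) (F::nat \<Rightarrow> mpol) (w0::int vec) (\<tau>::nat) (N::nat) (a::int vec).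
           prime p \<longrightarrow>
           exponent_matrix m S \<longrightarrow>
           (\<Prod>i<m. S $$ (i, i + 1)) \<noteq> 0 \<longrightarrow>
           F \<in> poly_systems p S m \<longrightarrow>
           system_deg m F = ereal (real d) \<longrightarrow>
           w0 \<in> Fp_vec p (m + 1) \<longrightarrow>
           purely_periodic (orbit p m F w0) \<tau> \<longrightarrow>
           0 < N \<and> N \<le> \<tau> \<longrightarrow>
           a \<in> Fp_vec p m \<and> a \<noteq> 0\<^sub>v m \<longrightarrow>
           cmod (\<Sum>n<N. e\<^sub>p p (\<Sum>i<m. a $ i * orbit p m F w0 n $ i))
             \<le> c * real N powr (1 - \<beta> m \<nu>) * real p powr (\<alpha> m \<nu>)"
proof -
  define C where "C = (real (\<nu> ^ \<nu>) + real ((d + 1) * 2 ^ m * 2 ^ (m + \<nu>))) powr (1 / (2 * real \<nu>)) + 2"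
  (* The second entry covers the primes up to nu, where N \<le> p^(m+1) \<le> nu^(m+1). *)
  define c where "c = max C (real \<nu> ^ (m + 1))"
  have C: "C > 0" unfolding C_def by (intro add_nonneg_pos) auto
  then have "c > 0" by (simp add: c_def)
  moreover have "cmod (\<Sum>n<N. e\<^sub>p p (\<Sum>i<m. a $ i * orbit p m F w0 n $ i))
             \<le> c * real N powr (1 - \<beta> m \<nu>) * real p powr (\<alpha> m \<nu>)"
    if p: "prime p" and S: "(\<Prod>i<m. S $$ (i, i + 1)) \<noteq> 0" and F: "F \<in> poly_systems p S m"
      and deg: "system_deg m F = ereal (real d)" and w0: "w0 \<in> Fp_vec p (m + 1)"
      and per: "purely_periodic (orbit p m F w0) \<tau>" and N: "0 < N" "N \<le> \<tau>"
      and a: "a \<in> Fp_vec p m" "a \<noteq> 0\<^sub>v m"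
    for p and S :: "nat mat" and F w0 \<tau> N and a :: "int vec"
  proof -
    define Y where "Y = real N powr (1 - \<beta> m \<nu>) * real p powr (\<alpha> m \<nu>)"
    obtain G H where tri: "triangular_map p m (\<lambda>i. S $$ (i, i + 1)) G H"
      and T: "\<And>i v. i \<le> m \<Longrightarrow> eval_mod p (F i) v = triangular_map.T G H (\<lambda>j. v $ j) i mod int p"
      using poly_system_triangular[OF p F] by blast
    interpret triangular_map p m "\<lambda>i. S $$ (i, i + 1)" G H by (rule tri)
    have s: "1 \<le> S $$ (i, i + 1) \<and> S $$ (i, i + 1) \<le> d" if i: "i < m" for i
    proof
      have "S $$ (i, i + 1) \<noteq> 0" using S i by simp
      then show "1 \<le> S $$ (i, i + 1)" by linarith
      show "S $$ (i, i + 1) \<le> d" using exponent_le_system_deg[OF F i] deg by simp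
    qed
    have Y: "Y \<ge> 0" by (simp add: Y_def)
    show ?thesis
    proof (cases "\<nu> < p")
      case True
      obtain i where i: "i < m" "\<And>j. j < i \<Longrightarrow> a $ j = 0" "\<not> int p dvd a $ i"
        using nonzero_Fp_vec_first_entry[OF a] by blast
      have "cmod (\<Sum>n<N. e\<^sub>p p (\<Sum>i<m. a $ i * orbit p m F w0 n $ i)) \<le> C * Y"
        using orbit_sum_bound[where a = "\<lambda>j. a $ j" and i = i, OF T w0 per N s i assms(3) True] by (simp only: C_def Y_def mult.assoc)
      also have "\<dots> \<le> c * Y" using Y by (intro mult_right_mono) (simp_all add: c_def)
      finally show ?thesis by (simp only: Y_def mult.assoc)
    next
      case False
      have "cmod (\<Sum>n<N. e\<^sub>p p (\<Sum>i<m. a $ i * orbit p m F w0 n $ i)) \<le> real N"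
        using sum_norm_le[of "{..<N}" "\<lambda>n. e\<^sub>p p (\<Sum>i<m. a $ i * orbit p m F w0 n $ i)" "\<lambda>_. 1"] by simp
      also have "real N \<le> real \<nu> ^ (m + 1)"
      proof -
        have "N \<le> \<nu> ^ (m + 1)"
          using N(2) period_le[OF p_pos w0 per] power_mono[of p \<nu> "m + 1"] False by linarith
        then show ?thesis by (metis of_nat_le_iff of_nat_power)
      qed
      also have "\<dots> \<le> c * 1" by (simp add: c_def)
      also have "\<dots> \<le> c * Y"
      proof (rule mult_left_mono)
        have "1 \<le> real N powr (1 - \<beta> m \<nu>)"
          using N assms(3) by (intro ge_one_powr_ge_zero) (auto simp: \<beta>_def field_simps)
        moreover have "0 \<le> \<beta> m \<nu>" by (simp add: \<beta>_def)
        then have "1 \<le> real p powr (\<alpha> m \<nu>)"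
          using p_pos beta_le_alpha[OF assms(1,3)] by (intro ge_one_powr_ge_zero) auto
        ultimately show "1 \<le> Y" unfolding Y_def using mult_mono[of 1 _ 1] by fastforce
      qed (use \<open>c > 0\<close> in simp)
      finally show ?thesis by (simp only: Y_def mult.assoc)
    qed
  qed
  ultimately show ?thesis by blast
qed

end
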